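(* If two $Y$-oriented spatial trivalent graph diagrams $\Gamma$ and $\Gamma'$ representing $S^1$-oriented handlebody-knots are related by (handlebody-knot) Reidemeister moves, then for any group $G$ and any $G$-family of biquandles $X$, their $G$-enhanced biquandle counting invariants agree: $$\Phi_X^G(\Gamma)=\Phi_X^G(\Gamma').$$
   Context: Let $G$ be a group. A $G$-family of biquandles is a set $X$ with operations $\underline{\triangleright}^g,\overline{\triangleright}^g:X\times X\to X$ for each $g\in G$ such that for all $g,h\in G$, $a,b,c\in X$: (i) $a\,\underline{\triangleright}^g a=a\,\overline{\triangleright}^g a$; (ii) $x\mapsto x\,\underline{\triangleright}^g a$ and $x\mapsto x\,\overline{\triangleright}^g a$ are bijections of $X$, and $(x,y)\mapsto(y\,\overline{\triangleright}^g x,\ x\,\underline{\triangleright}^h y)$ is a bijection of $X\times X$; (iii) $(a\,\underline{\triangleright}^g b)\,\underline{\triangleright}^h(c\,\overline{\triangleright}^g b)=(a\,\underline{\triangleright}^h c)\,\underline{\triangleright}^{h^{-1}gh}(b\,\underline{\triangleright}^h c)$, $(a\,\overline{\triangleright}^g b)\,\underline{\triangleright}^h(c\,\overline{\triangleright}^g b)=(a\,\underline{\triangleright}^h c)\,\overline{\triangleright}^{h^{-1}gh}(b\,\underline{\triangleright}^h c)$, $(a\,\overline{\triangleright}^g b)\,\overline{\triangleright}^h(c\,\overline{\triangleright}^g b)=(a\,\overline{\triangleright}^h c)\,\overline{\triangleright}^{h^{-1}gh}(b\,\underline{\triangleright}^h c)$; (iv) $a\,\underline{\triangleright}^{gh}b=(a\,\underline{\triangleright}^g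 b)\,\underline{\triangleright}^h(b\,\underline{\triangleright}^g b)$ and $a\,\overline{\triangleright}^{gh}b=(a\,\overline{\triangleright}^g b)\,\overline{\triangleright}^h(b\,\overline{\triangleright}^g b)$. The associated partially multiplicative biquandle is $Q=X\times G$ with $(a,g)\,\underline{\triangleright}\,(b,h)=(a\,\underline{\triangleright}^h b,\,h^{-1}gh)$, $(a,g)\,\overline{\triangleright}\,(b,h)=(a\,\overline{\triangleright}^h b,\,g)$, and partial product defined on $D=\{((a,g),(a\,\underline{\triangleright}^g a,h)) : a\in X,\ g,h\in G\}$ by $(a,g)\cdot(a\,\underline{\triangleright}^g a,h)=(a,gh)$. A spatial trivalent graph diagram is a regular planar diagram, with over/under crossing information, of a finite trivalent graph (circle components allowed) embedded in $S^3$; it represents the handlebody-knot given by a regular neighborhood of the graph. A $Y$-orientation is a choice of direction of every edge such that no vertex is a source or a sink; an $S^1$-orientation of a handlebody-knot corresponds to a $Y$-orientation of a representing spatial trivalent graph. Semiarcs are the portions of the diagram between consecutive under-crossing points, over-crossing points and vertices. An $X$-coloring of a $Y$-oriented diagram assigns an element of $Q$ to each semiarc such that: - at each crossing, if $x$ is the color of the under-strand semiarc lying to the right of the (oriented) over-strand, and $y$ is the color of the over-strand semiarc lying to the right of the (oriented) under-strand, then the under-strand semiarc to the left of the over-strand has color $x\,\underline{\triangleright}\,y$ and the over-strand semiarc to the left of the under-strand has color $y\,\overline{\triangleright}\,x$; - at each vertex, two of the three edges are both incoming or both outgoing; drawing the vertex locally so that all three edges point upward, if the right one and the left one of these two edges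 have colors $p$ and $q$ respectively, then $(p,q)\in D$ and the third edge has color $p\cdot q$. A $G$-coloring is an assignment of elements of $G$ to the semiarcs satisfying the same rules with $g\,\underline{\triangleright}\,h=h^{-1}gh$, $g\,\overline{\triangleright}\,h=g$, and the vertex product being multiplication in $G$ (defined on all of $G\times G$). $G$-colorings of $\Gamma$ are identified with homomorphisms $\psi\in\mathrm{Hom}(\pi_1(S^3\setminus\Gamma),G)$. Forgetting the first component, $(a,g)\mapsto g$, on each semiarc sends an $X$-coloring to a $G$-coloring; $\pi^{-1}(\psi)$ denotes the set of $X$-colorings that project to $\psi$. The $G$-enhanced biquandle counting invariant is the polynomial $$\Phi_X^G(\Gamma)=\sum_{\psi\in\mathrm{Hom}(\pi_1(S^3\setminus\Gamma),G)}u^{|\pi^{-1}(\psi)|}.$$ The handlebody-knot Reidemeister moves, each supported in a disc with both sides $Y$-oriented compatibly with the orientation outside the disc, are: the classical Reidemeister moves I, II, III; moving a strand across a vertex, passing entirely over or entirely under it; adding or removing a crossing between two of the edges adjacent to a vertex (twisting the two edges around each other at the vertex); and the IH move, which replaces two vertices joined by a crossingless edge in a disc with four boundary points by the other planar trivalent tree with one internal edge on the same four boundary points. *)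

theory Defs
  imports
    "HOL-Algebra.Group"
    "HOL-Library.Multiset"
    "HOL-Library.Equipollence"
    "HOL-Computational_Algebra.Polynomial"
begin

section \<open>Families of biquandles\<close>

text \<open>\<open>un g a b\<close> is the paper's under-operation with exponent \<open>g\<close> applied to \<open>a\<close>, \<open>b\<close>
  (underlined triangle), \<open>ov g a b\<close> the over-operation (overlined triangle).\<close>

locale G_family_of_biquandles = group G
  for G :: "('g, 'm) monoid_scheme" (structure) +
  fixes X :: "'x set"
    and un :: "'g \<Rightarrow> 'x \<Rightarrow> 'x \<Rightarrow> 'x"
    and ov :: "'g \<Rightarrow> 'x \<Rightarrow> 'x \<Rightarrow> 'x"
  assumes un_closed: "\<lbrakk>g \<in> carrier G; a \<in> X; b \<in> X\<rbrakk> \<Longrightarrow> un g a b \<in> X"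
    and ov_closed: "\<lbrakk>g \<in> carrier G; a \<in> X; b \<in> X\<rbrakk> \<Longrightarrow> ov g a b \<in> X"
    and diag: "\<lbrakk>g \<in> carrier G; a \<in> X\<rbrakk> \<Longrightarrow> un g a a = ov g a a"
    and un_bij: "\<lbrakk>g \<in> carrier G; a \<in> X\<rbrakk> \<Longrightarrow> bij_betw (\<lambda>x. un g x a) X X"
    and ov_bij: "\<lbrakk>g \<in> carrier G; a \<in> X\<rbrakk> \<Longrightarrow> bij_betw (\<lambda>x. ov g x a) X X"
    and pair_bij: "\<lbrakk>g \<in> carrier G; h \<in> carrier G\<rbrakk> \<Longrightarrow>
      bij_betw (\<lambda>(x, y). (ov g y x, un h x y)) (X \<times> X) (X \<times> X)"
    and exchange_un_un: "\<lbrakk>g \<in> carrier G; h \<in> carrier G; a \<in> X; b \<in> X; c \<in> X\<rbrakk> \<Longrightarrow>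
      un h (un g a b) (ov g c b) = un (inv h \<otimes> g \<otimes> h) (un h a c) (un h b c)"
    and exchange_ov_un: "\<lbrakk>g \<in> carrier G; h \<in> carrier G; a \<in> X; b \<in> X; c \<in> X\<rbrakk> \<Longrightarrow>
      un h (ov g a b) (ov g c b) = ov (inv h \<otimes> g \<otimes> h) (un h a c) (un h b c)"
    and exchange_ov_ov: "\<lbrakk>g \<in> carrier G; h \<in> carrier G; a \<in> X; b \<in> X; c \<in> X\<rbrakk> \<Longrightarrow>
      ov h (ov g a b) (ov g c b) = ov (inv h \<otimes> g \<otimes> h) (ov h a c) (un h b c)"
    and un_mult: "\<lbrakk>g \<in> carrier G; h \<in> carrier G; a \<in> X; b \<in> X\<rbrakk> \<Longrightarrow>
      un (g \<otimes> h) a b = un h (un g a b) (un g b b)"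
    and ov_mult: "\<lbrakk>g \<in> carrier G; h \<in> carrier G; a \<in> X; b \<in> X\<rbrakk> \<Longrightarrow>
      ov (g \<otimes> h) a b = ov h (ov g a b) (ov g b b)"

text \<open>The associated partially multiplicative biquandle on \<open>X \<times> carrier G\<close>.\<close>

definition Q_un ::
  "('g, 'm) monoid_scheme \<Rightarrow> ('g \<Rightarrow> 'x \<Rightarrow> 'x \<Rightarrow> 'x) \<Rightarrow> 'x \<times> 'g \<Rightarrow> 'x \<times> 'g \<Rightarrow> 'x \<times> 'g" where
  "Q_un G un p q =
     (un (snd q) (fst p) (fst q), inv\<^bsub>G\<^esub> (snd q) \<otimes>\<^bsub>G\<^esub> snd p \<otimes>\<^bsub>G\<^esub> snd q)"

definition Q_ov :: "('g \<Rightarrow> 'x \<Rightarrow> 'x \<Rightarrow> 'x) \<Rightarrow> 'x \<times> 'g \<Rightarrow> 'x \<times> 'g \<Rightarrow> 'x \<times> 'g" where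
  "Q_ov ov p q = (ov (snd q) (fst p) (fst q), snd p)"

definition Q_dom ::
  "('g, 'm) monoid_scheme \<Rightarrow> 'x set \<Rightarrow> ('g \<Rightarrow> 'x \<Rightarrow> 'x \<Rightarrow> 'x) \<Rightarrow> (('x \<times> 'g) \<times> ('x \<times> 'g)) set" where
  "Q_dom G X un =
     {((a, g), (un g a a, h)) | a g h. a \<in> X \<and> g \<in> carrier G \<and> h \<in> carrier G}"

definition Q_mult :: "('g, 'm) monoid_scheme \<Rightarrow> 'x \<times> 'g \<Rightarrow> 'x \<times> 'g \<Rightarrow> 'x \<times> 'g" where
  "Q_mult G p q = (fst p, snd p \<otimes>\<^bsub>G\<^esub> snd q)"

section \<open>Oriented spatial trivalent graph diagrams\<close>

text \<open>
  A diagram is given by its oriented planar-diagram code.  Semiarcs are named by natural numbers.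
  The dart \<open>(e, True)\<close> is the head of the oriented semiarc \<open>e\<close>, i.e.\ the end at which \<open>e\<close>
  runs into a crossing or vertex, and \<open>(e, False)\<close> is its tail.  A node lists the
  darts around it in counterclockwise order; in \<open>Crossing a b c d\<close> the darts \<open>a\<close>, \<open>c\<close> belong to the
  under-strand and \<open>b\<close>, \<open>d\<close> to the over-strand.  A semiarc neither of whose darts occurs in a
  node is a circle component without crossings.
\<close>

type_synonym dart = "nat \<times> bool"

datatype 'd node = Crossing 'd 'd 'd 'd | Vertex 'd 'd 'd

datatype diagram = Diagram (semiarcs: "nat set") (nodes: "dart node multiset")

fun flip :: "dart \<Rightarrow> dart" where
  "flip (e, s) = (e, \<not> s)"

fun node_darts :: "'d node \<Rightarrow> 'd multiset" where
  "node_darts (Crossing a b c d) = {#a, b, c, d#}"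
| "node_darts (Vertex a b c) = {#a, b, c#}"

definition dart_mset :: "diagram \<Rightarrow> dart multiset" where
  "dart_mset D = (\<Sum>n\<in>#nodes D. node_darts n)"

fun node_next :: "'d node \<Rightarrow> ('d \<times> 'd) set" where
  "node_next (Crossing a b c d) = {(a, b), (b, c), (c, d), (d, a)}"
| "node_next (Vertex a b c) = {(a, b), (b, c), (c, a)}"

definition next_rel :: "diagram \<Rightarrow> (dart \<times> dart) set" where
  "next_rel D = (\<Union>n\<in>set_mset (nodes D). node_next n)"

definition face_rel :: "diagram \<Rightarrow> (dart \<times> dart) set" where
  "face_rel D = {(x, y). (flip x, y) \<in> next_rel D}\<^sup>*"

definition component_rel :: "diagram \<Rightarrow> (dart \<times> dart) set" where
  "component_rel D = (next_rel D \<union> {(x, flip x) | x. x \<in># dart_mset D})\<^sup>*"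

text \<open>
  The combinatorial map of the code is drawn on the sphere iff every connected component has
  genus 0.  No component can have Euler characteristic above 2, so this is the single equation
  \<open>V - E + F = 2 c\<close>.  Circles without crossings do not contribute.
\<close>

definition planar :: "diagram \<Rightarrow> bool" where
  "planar D \<longleftrightarrow>
     size (nodes D) + card (set_mset (dart_mset D) // face_rel D) =
     card (fst ` set_mset (dart_mset D)) + 2 * card (set_mset (dart_mset D) // component_rel D)"

text \<open>Strands keep their direction through crossings, and no vertex is a source or a sink.\<close>

fun Y_oriented_node :: "dart node \<Rightarrow> bool" where
  "Y_oriented_node (Crossing a b c d) \<longleftrightarrow> snd a \<noteq> snd c \<and> snd b \<noteq> snd d"
| "Y_oriented_node (Vertex a b c) \<longleftrightarrow> \<not> (snd a = snd b \<and> snd b = snd c)"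

definition Y_oriented_diagram :: "diagram \<Rightarrow> bool" where
  "Y_oriented_diagram D \<longleftrightarrow>
     finite (semiarcs D) \<and>
     fst ` set_mset (dart_mset D) \<subseteq> semiarcs D \<and>
     (\<forall>e \<in> semiarcs D.
        (count (dart_mset D) (e, True) = 1 \<and> count (dart_mset D) (e, False) = 1) \<or>
        (count (dart_mset D) (e, True) = 0 \<and> count (dart_mset D) (e, False) = 0)) \<and>
     (\<forall>n \<in># nodes D. Y_oriented_node n) \<and>
     planar D"

section \<open>Reidemeister moves\<close>

text \<open>
  \<open>handlebody_move I T I' T' w\<close>: inside a disc, the tangle with nodes \<open>T\<close> and inner
  semiarcs \<open>I\<close> is replaced by the tangle with nodes \<open>T'\<close> and inner semiarcs \<open>I'\<close>.  The remaining
  darts of \<open>T\<close> are the ends of the semiarcs that leave the disc; as they are arbitrary darts, every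
  choice of directions is covered, subject to both diagrams being \<open>Y\<close>-oriented.  When \<open>T'\<close>
  consists of strands without crossings, each pair in \<open>w\<close> names the two semiarcs
  of the old diagram that become one.

  Boundary positions, counterclockwise: \<open>q, r, t, p\<close> in \<open>R2\<close>, with over-strand \<open>p\<close>--\<open>t\<close>;
  \<open>p0, \<dots>, p5\<close> in \<open>R3\<close>, with strands \<open>p0\<close>--\<open>p3\<close> (on top), \<open>p1\<close>--\<open>p4\<close>, \<open>p2\<close>--\<open>p5\<close>,
  where up to rotation of the disc the two rules are the two possible orders of the lower strands;
  \<open>s, x, y, t, z\<close> in the vertex-passing moves, with moving strand \<open>s\<close>--\<open>t\<close>
  (passing from crossing no edge to crossing all three is one such move together with \<open>R2\<close>);
  \<open>p, q, z\<close> in the twist moves; \<open>a, b, c, d\<close> in \<open>IH\<close>.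
\<close>

inductive handlebody_move ::
  "nat set \<Rightarrow> dart node multiset \<Rightarrow> nat set \<Rightarrow> dart node multiset \<Rightarrow> (nat \<times> nat) list \<Rightarrow> bool" where
  R1_a: "handlebody_move {e} {#Crossing p q (e, i) (e, \<not> i)#} {} {#} [(fst p, fst q)]"
| R1_b: "handlebody_move {e} {#Crossing (e, i) p q (e, \<not> i)#} {} {#} [(fst p, fst q)]"
| R2: "handlebody_move {e, f}
    {#Crossing q (e, i) (f, j) p, Crossing r t (f, \<not> j) (e, \<not> i)#}
    {} {#} [(fst p, fst t), (fst q, fst r)]"
| R3_a: "handlebody_move
    {a, b, c}
    {#Crossing p1 (a, i) (b, j) p0, Crossing p2 p3 (c, k) (a, \<not> i),
      Crossing (c, \<not> k) p4 p5 (b, \<not> j)#}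
    {a', b', c'}
    {#Crossing (c', k') (a', i') p5 p0, Crossing (b', j') p3 p4 (a', \<not> i'),
      Crossing p2 (b', \<not> j') (c', \<not> k') p1#}
    []"
| R3_b: "handlebody_move
    {a, b, c}
    {#Crossing p1 (a, i) (b, j) p0, Crossing p2 p3 (c, k) (a, \<not> i),
      Crossing (b, \<not> j) (c, \<not> k) p4 p5#}
    {a', b', c'}
    {#Crossing (c', k') (a', i') p5 p0, Crossing (b', j') p3 p4 (a', \<not> i'),
      Crossing p1 p2 (b', \<not> j') (c', \<not> k')#}
    []"
| strand_over_vertex: "handlebody_move
    {e}
    {#Vertex x y (e, i), Crossing (e, \<not> i) t z s#}
    {a, b, m}
    {#Vertex (a, j) (b, k) z, Crossing x (m, l) (a, \<not> j) s, Crossing y t (b, \<not> k) (m, \<not> l)#}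
    []"
| strand_under_vertex: "handlebody_move
    {e}
    {#Vertex x y (e, i), Crossing s (e, \<not> i) t z#}
    {a, b, m}
    {#Vertex (a, j) (b, k) z, Crossing s x (m, l) (a, \<not> j), Crossing (m, \<not> l) y t (b, \<not> k)#}
    []"
| twist_a: "handlebody_move
    {a, b} {#Vertex (a, i) (b, j) z, Crossing (a, \<not> i) p q (b, \<not> j)#}
    {} {#Vertex p q z#} []"
| twist_b: "handlebody_move
    {a, b} {#Vertex (a, i) (b, j) z, Crossing (b, \<not> j) (a, \<not> i) p q#}
    {} {#Vertex p q z#} []"
| IH: "handlebody_move
    {e} {#Vertex a b (e, i), Vertex c d (e, \<not> i)#}
    {f} {#Vertex b c (f, j), Vertex d a (f, \<not> j)#} []"

definition relabel :: "(nat \<Rightarrow> nat) \<Rightarrow> diagram \<Rightarrow> diagram" where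
  "relabel r D = Diagram (r ` semiarcs D) (image_mset (map_node (apfst r)) (nodes D))"

text \<open>
  Joining semiarcs identifies their names; joining the two ends of a single semiarc leaves it as a
  circle component.  Later pairs refer to the names after the earlier joins.
\<close>

fun join :: "(nat \<times> nat) list \<Rightarrow> diagram \<Rightarrow> diagram" where
  "join [] D = D"
| "join ((x, y) # w) D =
     (let r = id(y := x) in join (map (map_prod r r) w) (relabel r D))"

text \<open>The first three rules say when two codes describe the same planar diagram.\<close>

inductive diagram_step :: "diagram \<Rightarrow> diagram \<Rightarrow> bool" where
  rename: "inj_on r (semiarcs D) \<Longrightarrow> diagram_step D (relabel r D)"
| rotate_crossing:
    "diagram_step (Diagram S (add_mset (Crossing a b c d) M))
                  (Diagram S (add_mset (Crossing c d a b) M))"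
| rotate_vertex:
    "diagram_step (Diagram S (add_mset (Vertex a b c) M)) (Diagram S (add_mset (Vertex b c a) M))"
| move: "\<lbrakk>handlebody_move I T I' T' w; S \<inter> I = {}; S \<inter> I' = {}\<rbrakk> \<Longrightarrow>
    diagram_step (Diagram (S \<union> I) (M + T)) (join w (Diagram (S \<union> I') (M + T')))"

definition Reidemeister_related :: "diagram \<Rightarrow> diagram \<Rightarrow> bool" where
  "Reidemeister_related =
     equivclp (\<lambda>D D'. Y_oriented_diagram D \<and> Y_oriented_diagram D' \<and> diagram_step D D')"

section \<open>Colorings and the enhanced counting invariant\<close>

text \<open>
  At \<open>Crossing a b c d\<close> place \<open>a, b, c, d\<close> at south, east, north, west.  If \<open>a\<close> is incoming, the
  under-strand runs north and \<open>b\<close> lies to its right; if \<open>b\<close> is incoming, the over-strand runs west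
  and \<open>c\<close> lies to its right.
\<close>

definition right_under :: "dart \<Rightarrow> dart \<Rightarrow> dart \<Rightarrow> dart \<Rightarrow> nat" where
  "right_under a b c d = fst (if snd b then c else a)"

definition left_under :: "dart \<Rightarrow> dart \<Rightarrow> dart \<Rightarrow> dart \<Rightarrow> nat" where
  "left_under a b c d = fst (if snd b then a else c)"

definition right_over :: "dart \<Rightarrow> dart \<Rightarrow> dart \<Rightarrow> dart \<Rightarrow> nat" where
  "right_over a b c d = fst (if snd a then b else d)"

definition left_over :: "dart \<Rightarrow> dart \<Rightarrow> dart \<Rightarrow> dart \<Rightarrow> nat" where
  "left_over a b c d = fst (if snd a then d else b)"

text \<open>
  At a vertex let \<open>t\<close> be the dart whose direction differs from that of the other two, \<open>u\<close>, \<open>v\<close>,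
  with \<open>t, u, v\<close> counterclockwise.  Drawn with all edges pointing upward, \<open>t\<close> is at the top if it is
  outgoing, and then \<open>u\<close> is the left one; it is at the bottom if it is incoming, and then \<open>u\<close> is
  the right one.  The result lists the right, left and third edge.
\<close>

definition right_left_third_at :: "dart \<Rightarrow> dart \<Rightarrow> dart \<Rightarrow> nat \<times> nat \<times> nat" where
  "right_left_third_at t u v =
     (if snd t then (fst u, fst v, fst t) else (fst v, fst u, fst t))"

definition right_left_third :: "dart \<Rightarrow> dart \<Rightarrow> dart \<Rightarrow> nat \<times> nat \<times> nat" where
  "right_left_third a b c =
     (if snd b = snd c then right_left_third_at a b c
      else if snd c = snd a then right_left_third_at b c a
      else right_left_third_at c a b)"

text \<open>\<open>mul p q t\<close> says that \<open>p \<cdot> q\<close> is defined and equals \<open>t\<close>.\<close>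

fun obeys_rule ::
  "('q \<Rightarrow> 'q \<Rightarrow> 'q) \<Rightarrow> ('q \<Rightarrow> 'q \<Rightarrow> 'q) \<Rightarrow> ('q \<Rightarrow> 'q \<Rightarrow> 'q \<Rightarrow> bool) \<Rightarrow> (nat \<Rightarrow> 'q) \<Rightarrow>
   dart node \<Rightarrow> bool" where
  "obeys_rule un ov mul f (Crossing a b c d) \<longleftrightarrow>
     (let x = f (right_under a b c d); y = f (right_over a b c d)
      in f (left_under a b c d) = un x y \<and> f (left_over a b c d) = ov y x)"
| "obeys_rule un ov mul f (Vertex a b c) \<longleftrightarrow>
     (case right_left_third a b c of (r, l, t) \<Rightarrow> mul (f r) (f l) (f t))"

definition colorings ::
  "'q set \<Rightarrow> ('q \<Rightarrow> 'q \<Rightarrow> 'q) \<Rightarrow> ('q \<Rightarrow> 'q \<Rightarrow> 'q) \<Rightarrow> ('q \<Rightarrow> 'q \<Rightarrow> 'q \<Rightarrow> bool) \<Rightarrow>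
   diagram \<Rightarrow> (nat \<Rightarrow> 'q) set" where
  "colorings Q un ov mul D =
     {f \<in> semiarcs D \<rightarrow>\<^sub>E Q. \<forall>n \<in># nodes D. obeys_rule un ov mul f n}"

definition X_colorings ::
  "('g, 'm) monoid_scheme \<Rightarrow> 'x set \<Rightarrow> ('g \<Rightarrow> 'x \<Rightarrow> 'x \<Rightarrow> 'x) \<Rightarrow> ('g \<Rightarrow> 'x \<Rightarrow> 'x \<Rightarrow> 'x) \<Rightarrow>
   diagram \<Rightarrow> (nat \<Rightarrow> 'x \<times> 'g) set" where
  "X_colorings G X un ov =
     colorings (X \<times> carrier G) (Q_un G un) (Q_ov ov)
       (\<lambda>p q t. (p, q) \<in> Q_dom G X un \<and> t = Q_mult G p q)"

text \<open>This set plays the role of the set of homomorphisms from the fundamental group of the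
  complement of the graph to \<open>G\<close> (Wirtinger presentation).\<close>

definition G_colorings :: "('g, 'm) monoid_scheme \<Rightarrow> diagram \<Rightarrow> (nat \<Rightarrow> 'g) set" where
  "G_colorings G =
     colorings (carrier G) (\<lambda>g h. inv\<^bsub>G\<^esub> h \<otimes>\<^bsub>G\<^esub> g \<otimes>\<^bsub>G\<^esub> h) (\<lambda>g h. g) (\<lambda>g h k. k = g \<otimes>\<^bsub>G\<^esub> h)"

definition fiber ::
  "('g, 'm) monoid_scheme \<Rightarrow> 'x set \<Rightarrow> ('g \<Rightarrow> 'x \<Rightarrow> 'x \<Rightarrow> 'x) \<Rightarrow> ('g \<Rightarrow> 'x \<Rightarrow> 'x \<Rightarrow> 'x) \<Rightarrow>
   diagram \<Rightarrow> (nat \<Rightarrow> 'g) \<Rightarrow> (nat \<Rightarrow> 'x \<times> 'g) set" where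
  "fiber G X un ov D \<psi> =
     {f \<in> X_colorings G X un ov D. restrict (\<lambda>e. snd (f e)) (semiarcs D) = \<psi>}"

definition Phi ::
  "('g, 'm) monoid_scheme \<Rightarrow> 'x set \<Rightarrow> ('g \<Rightarrow> 'x \<Rightarrow> 'x \<Rightarrow> 'x) \<Rightarrow> ('g \<Rightarrow> 'x \<Rightarrow> 'x \<Rightarrow> 'x) \<Rightarrow>
   diagram \<Rightarrow> int poly" where
  "Phi G X un ov D = (\<Sum>\<psi>\<in>G_colorings G D. monom 1 (card (fiber G X un ov D \<psi>)))"

text \<open>
  When \<open>G\<close> or \<open>X\<close> is infinite, \<open>Phi\<close> is only a formal sum, with cardinals as
  exponents and coefficients: its coefficient at \<open>u\<close> to the power \<open>|K|\<close> is the cardinality of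
  \<open>Phi_terms G X un ov D K\<close>.
\<close>

definition Phi_terms ::
  "('g, 'm) monoid_scheme \<Rightarrow> 'x set \<Rightarrow> ('g \<Rightarrow> 'x \<Rightarrow> 'x \<Rightarrow> 'x) \<Rightarrow> ('g \<Rightarrow> 'x \<Rightarrow> 'x \<Rightarrow> 'x) \<Rightarrow>
   diagram \<Rightarrow> (nat \<Rightarrow> 'x \<times> 'g) set \<Rightarrow> (nat \<Rightarrow> 'g) set" where
  "Phi_terms G X un ov D K = {\<psi> \<in> G_colorings G D. fiber G X un ov D \<psi> \<approx> K}"

end

theory Submission
  imports Defs
begin

text \<open>
  The color of a semiarc depends on the direction of the semiarc only in appearance.  On
  \<open>Q = X \<times> G\<close> the map \<open>opp (a, g) = (un g a a, g\<^sup>-\<^sup>1)\<close> is an involution, and the axioms of a family imply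
  that a coloring stays a coloring when a strand is reversed and its colors are replaced by their
  images under \<open>opp\<close>.  So every end of a semiarc can be given the color that the semiarc has when
  directed toward the node at that end (\<open>toward\<close>).  The two ends of a semiarc carry colors
  exchanged by \<open>opp\<close>, and each node imposes one relation on the colors around it, \<open>cross\<close> or \<open>vert\<close>,
  which does not mention directions and is invariant under rotation of the node.

  In this form every move is a single algebraic statement in place of one for each choice of directions.
  At a crossing two neighboring colors determine the other two, which gives the second
  Reidemeister move; the first one needs moreover that \<open>x \<mapsto> x \<rightharpoondown> x\<close> is invertible on \<open>Q\<close>.  The third one
  is the exchange laws.  A strand passes a vertex because the operations are multiplicative,
  a twist at a vertex keeps the product because it rewrites \<open>x y\<close> as \<open>(x y x\<^sup>-\<^sup>1) x\<close> or
  \<open>y (y\<^sup>-\<^sup>1 x y)\<close>, and the IH move is associativity.  In each case the colors inside the disc are determined by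
  those on its boundary, and the two sides of the move admit the same boundary colors
  (\<open>handlebody_move_interchangeable\<close>).  Colorings of both diagrams are therefore the same thing as
  functions on the semiarcs outside the disc that satisfy the same conditions.

  All this uses only the laws collected in the locale \<open>reversible_biquandle\<close>.  The group \<open>G\<close> with
  conjugation is another instance, so \<open>G\<close>-colorings are treated alike.  Forgetting the first
  component of a color commutes with restriction to the boundary; hence corresponding
  \<open>G\<close>-colorings have equipotent fibers.  This yields both the equality of the polynomials and the
  equipotence of the sets of terms (\<open>same_invariant_of_same_boundary\<close>), and the theorem follows by
  induction on the number of steps.
\<close>

section \<open>Biquandles with reversal of direction\<close>

text \<open>
  The last argument \<open>opp\<close> recolors a semiarc whose direction is reversed.  That the crossing rule
  survives reversing the over-strand is \<open>un_opp\<close> and \<open>opp_ov\<close>; for the under-strand it is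
  \<open>ov_opp\<close> and \<open>opp_un\<close>.  The law \<open>opp_square\<close> makes \<open>x \<mapsto> x \<rightharpoondown> x\<close> invertible, as
  the first Reidemeister move requires.  The laws on \<open>mul\<close> are the algebraic traces of the moves
  at a vertex: \<open>mul_rotate\<close> and \<open>mul_opp\<close> say that no edge is distinguished, \<open>mul_assoc\<close> belongs to
  the IH move, \<open>mul_un\<close>, \<open>mul_ov\<close>, \<open>un_mul\<close> and \<open>ov_mul\<close> to a strand passing the vertex, and the two
  swap laws, which in a group are \<open>x y = (x y x\<^sup>-\<^sup>1) x\<close> and \<open>x y = y (y\<^sup>-\<^sup>1 x y)\<close>, to the twist moves.
\<close>

locale reversible_biquandle =
  fixes Q :: "'q set"
    and un :: "'q \<Rightarrow> 'q \<Rightarrow> 'q" (infixl "\<rightharpoondown>" 70)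
    and ov :: "'q \<Rightarrow> 'q \<Rightarrow> 'q" (infixl "\<rightharpoonup>" 70)
    and mul :: "'q \<Rightarrow> 'q \<Rightarrow> 'q \<Rightarrow> bool"
    and opp :: "'q \<Rightarrow> 'q"
  assumes un_closed: "\<lbrakk>x \<in> Q; y \<in> Q\<rbrakk> \<Longrightarrow> x \<rightharpoondown> y \<in> Q"
    and ov_closed: "\<lbrakk>x \<in> Q; y \<in> Q\<rbrakk> \<Longrightarrow> x \<rightharpoonup> y \<in> Q"
    and opp_closed: "x \<in> Q \<Longrightarrow> opp x \<in> Q"
    and opp_opp: "x \<in> Q \<Longrightarrow> opp (opp x) = x"
    and un_self: "x \<in> Q \<Longrightarrow> x \<rightharpoondown> x = x \<rightharpoonup> x"
    and opp_square: "x \<in> Q \<Longrightarrow> opp (x \<rightharpoondown> x) \<rightharpoondown> opp (x \<rightharpoondown> x) = opp x"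
    and un_opp: "\<lbrakk>x \<in> Q; y \<in> Q\<rbrakk> \<Longrightarrow> (x \<rightharpoondown> y) \<rightharpoondown> opp y = x"
    and ov_opp: "\<lbrakk>x \<in> Q; y \<in> Q\<rbrakk> \<Longrightarrow> (x \<rightharpoonup> y) \<rightharpoonup> opp y = x"
    and opp_un: "\<lbrakk>x \<in> Q; y \<in> Q\<rbrakk> \<Longrightarrow> opp (x \<rightharpoondown> y) = opp x \<rightharpoondown> (y \<rightharpoonup> x)"
    and opp_ov: "\<lbrakk>x \<in> Q; y \<in> Q\<rbrakk> \<Longrightarrow> opp (x \<rightharpoonup> y) = opp x \<rightharpoonup> (y \<rightharpoondown> x)"
    and exchange_un_un: "\<lbrakk>x \<in> Q; y \<in> Q; z \<in> Q\<rbrakk> \<Longrightarrow>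
      (x \<rightharpoondown> y) \<rightharpoondown> (z \<rightharpoonup> y) = (x \<rightharpoondown> z) \<rightharpoondown> (y \<rightharpoondown> z)"
    and exchange_ov_un: "\<lbrakk>x \<in> Q; y \<in> Q; z \<in> Q\<rbrakk> \<Longrightarrow>
      (x \<rightharpoonup> y) \<rightharpoondown> (z \<rightharpoonup> y) = (x \<rightharpoondown> z) \<rightharpoonup> (y \<rightharpoondown> z)"
    and exchange_ov_ov: "\<lbrakk>x \<in> Q; y \<in> Q; z \<in> Q\<rbrakk> \<Longrightarrow>
      (x \<rightharpoonup> y) \<rightharpoonup> (z \<rightharpoonup> y) = (x \<rightharpoonup> z) \<rightharpoonup> (y \<rightharpoondown> z)"
    and mul_functional: "\<lbrakk>mul x y z; mul x y z'\<rbrakk> \<Longrightarrow> z = z'"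
    and mul_rotate: "\<lbrakk>mul x y z; x \<in> Q; y \<in> Q\<rbrakk> \<Longrightarrow> mul y (opp z) (opp x)"
    and mul_opp: "\<lbrakk>mul x y z; x \<in> Q; y \<in> Q\<rbrakk> \<Longrightarrow> mul (opp y) (opp x) (opp z)"
    and mul_assoc: "\<lbrakk>mul x y v; mul v z w; x \<in> Q; y \<in> Q; z \<in> Q\<rbrakk> \<Longrightarrow>
      \<exists>u\<in>Q. mul y z u \<and> mul x u w"
    and mul_un: "\<lbrakk>mul x y z; x \<in> Q; y \<in> Q; t \<in> Q\<rbrakk> \<Longrightarrow>
      mul (x \<rightharpoondown> t) (y \<rightharpoondown> (t \<rightharpoonup> x)) (z \<rightharpoondown> t)"
    and mul_ov: "\<lbrakk>mul x y z; x \<in> Q; y \<in> Q; t \<in> Q\<rbrakk> \<Longrightarrow>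
      mul (x \<rightharpoonup> t) (y \<rightharpoonup> (t \<rightharpoondown> x)) (z \<rightharpoonup> t)"
    and un_mul: "\<lbrakk>mul x y z; x \<in> Q; y \<in> Q; t \<in> Q\<rbrakk> \<Longrightarrow> t \<rightharpoondown> z = (t \<rightharpoondown> x) \<rightharpoondown> y"
    and ov_mul: "\<lbrakk>mul x y z; x \<in> Q; y \<in> Q; t \<in> Q\<rbrakk> \<Longrightarrow> t \<rightharpoonup> z = (t \<rightharpoonup> x) \<rightharpoonup> y"
    and mul_swap_un: "\<lbrakk>mul x y z; x \<in> Q; y \<in> Q\<rbrakk> \<Longrightarrow>
      mul (y \<rightharpoondown> opp x) (x \<rightharpoonup> (y \<rightharpoondown> opp x)) z"
    and mul_swap_ov: "\<lbrakk>mul x y z; x \<in> Q; y \<in> Q\<rbrakk> \<Longrightarrow>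
      mul (y \<rightharpoonup> opp x) (x \<rightharpoondown> (y \<rightharpoonup> opp x)) z"
begin

lemmas closed = un_closed ov_closed opp_closed

text \<open>
  The arguments are the colors of the four semiarcs at a crossing, in the order of \<^const>\<open>Crossing\<close> and all
  directed toward it.  The formula is the crossing rule with the under-strand running from \<open>a\<close> to
  \<open>c\<close> and the over-strand from \<open>b\<close> to \<open>d\<close>: the outgoing semiarcs then have colors \<open>opp c\<close> and
  \<open>opp d\<close>, and \<open>c\<close>, \<open>b\<close> are the ones on the right.
\<close>

definition cross :: "'q \<Rightarrow> 'q \<Rightarrow> 'q \<Rightarrow> 'q \<Rightarrow> bool" where
  "cross a b c d \<longleftrightarrow> a = opp c \<rightharpoondown> b \<and> opp d = b \<rightharpoonup> opp c"

text \<open>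
  The three edges, in counterclockwise order, are again directed toward the node.  Reversing \<open>c\<close>
  puts it at the top, with \<open>a\<close> at the lower left and \<open>b\<close> at the lower right.
\<close>

definition vert :: "'q \<Rightarrow> 'q \<Rightarrow> 'q \<Rightarrow> bool" where
  "vert a b c \<longleftrightarrow> mul b a (opp c)"

lemma cross_from_bc:
  assumes "a \<in> Q" "b \<in> Q" "c \<in> Q" "d \<in> Q"
  shows "cross a b c d \<longleftrightarrow> a = opp c \<rightharpoondown> b \<and> d = opp (b \<rightharpoonup> opp c)"
  using assms unfolding cross_def by (metis opp_opp ov_closed opp_closed)

text \<open>
  Two neighboring semiarcs determine the other two.  The four versions correspond to the
  four ways of directing the two strands; passing from one to another is the reversal of a strand.
\<close>

lemma cross_from_ab:
  assumes "a \<in> Q" "b \<in> Q" "c \<in> Q" "d \<in> Q"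
  shows "cross a b c d \<longleftrightarrow> c = opp (a \<rightharpoondown> opp b) \<and> d = opp b \<rightharpoonup> a"
proof
  assume "cross a b c d"
  then have *: "a = opp c \<rightharpoondown> b" "opp d = b \<rightharpoonup> opp c"
    by (auto simp: cross_def)
  then have "opp c = a \<rightharpoondown> opp b"
    using assms by (simp add: un_opp closed)
  moreover have "d = opp b \<rightharpoonup> a"
    using opp_ov[of b "opp c"] * assms by (simp add: opp_opp closed) (metis opp_opp)
  ultimately show "c = opp (a \<rightharpoondown> opp b) \<and> d = opp b \<rightharpoonup> a"
    using assms by (metis opp_opp)
next
  assume *: "c = opp (a \<rightharpoondown> opp b) \<and> d = opp b \<rightharpoonup> a"
  then have c: "opp c = a \<rightharpoondown> opp b"
    using assms by (simp add: opp_opp closed)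
  have "opp c \<rightharpoondown> b = a"
    using un_opp[of a "opp b"] assms c by (simp add: opp_opp closed)
  moreover have "opp d = b \<rightharpoonup> opp c"
    using opp_ov[of "opp b" a] * c assms by (simp add: opp_opp closed)
  ultimately show "cross a b c d"
    by (simp add: cross_def)
qed

lemma cross_rotate:
  assumes "a \<in> Q" "b \<in> Q" "c \<in> Q" "d \<in> Q"
  shows "cross a b c d \<longleftrightarrow> cross c d a b"
proof -
  have "cross c d a b" if "cross a b c d" "a \<in> Q" "b \<in> Q" "c \<in> Q" "d \<in> Q" for a b c d
  proof -
    have e: "a = opp c \<rightharpoondown> b" "d = opp (b \<rightharpoonup> opp c)"
      using that cross_from_bc by auto
    have "opp a = c \<rightharpoondown> opp d"
      using opp_un[of "opp c" b] e that by (simp add: opp_opp closed)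
    moreover have "b = opp d \<rightharpoonup> c"
      using ov_opp[of b "opp c"] e that by (simp add: opp_opp closed)
    ultimately show ?thesis
      using that by (simp add: cross_from_ab) (metis opp_opp)
  qed
  then show ?thesis using assms by blast
qed

lemma cross_from_cd:
  assumes "a \<in> Q" "b \<in> Q" "c \<in> Q" "d \<in> Q"
  shows "cross a b c d \<longleftrightarrow> a = opp (c \<rightharpoondown> opp d) \<and> b = opp d \<rightharpoonup> c"
  using cross_rotate[OF assms] cross_from_ab[of c d a b] assms by simp

lemma cross_from_da:
  assumes "a \<in> Q" "b \<in> Q" "c \<in> Q" "d \<in> Q"
  shows "cross a b c d \<longleftrightarrow> c = opp a \<rightharpoondown> d \<and> b = opp (d \<rightharpoonup> opp a)"
  using cross_rotate[OF assms] cross_from_bc[of c d a b] assms by simp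

lemma vert_rotate:
  assumes "a \<in> Q" "b \<in> Q" "c \<in> Q"
  shows "vert a b c \<longleftrightarrow> vert b c a"
proof -
  have "mul (opp (opp c)) b (opp a)" if "mul b a (opp c)"
    using mul_rotate[OF mul_rotate[OF that]] assms by (simp add: opp_opp closed)
  moreover have "mul b a (opp c)" if "mul c b (opp a)"
    using mul_rotate[OF that] assms by (simp add: opp_opp closed)
  ultimately show ?thesis
    using assms by (auto simp: vert_def opp_opp)
qed

definition toward :: "(nat \<Rightarrow> 'q) \<Rightarrow> dart \<Rightarrow> 'q" where
  "toward f d = (if snd d then f (fst d) else opp (f (fst d)))"

text \<open>
  Each of the four choices of directions matches one of the four solved forms of \<^const>\<open>cross\<close>.
\<close>

lemma obeys_rule_Crossing:
  assumes Y: "Y_oriented_node (Crossing a b c d)"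
    and f: "f (fst a) \<in> Q" "f (fst b) \<in> Q" "f (fst c) \<in> Q" "f (fst d) \<in> Q"
  shows "obeys_rule un ov mul f (Crossing a b c d) \<longleftrightarrow>
    cross (toward f a) (toward f b) (toward f c) (toward f d)"
proof -
  have Q: "toward f a \<in> Q" "toward f b \<in> Q" "toward f c \<in> Q" "toward f d \<in> Q"
    using f by (auto simp: toward_def closed)
  note simps = toward_def right_under_def left_under_def right_over_def left_over_def Let_def
    opp_opp closed
  have opp_eq: "opp x = opp y \<longleftrightarrow> x = y" if "x \<in> Q" "y \<in> Q" for x y
    using that by (metis opp_opp)
  consider "snd a" "snd b" | "snd a" "\<not> snd b" | "\<not> snd a" "snd b" | "\<not> snd a" "\<not> snd b"
    by blast
  then show ?thesis
  proof cases
    case 1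
    then show ?thesis
      using Y f by (simp add: simps cross_def)
  next
    case 2
    then show ?thesis
      using Y f by (simp add: cross_from_ab[OF Q]) (simp add: simps opp_eq)
  next
    case 3
    then show ?thesis
      using Y f by (simp add: cross_from_cd[OF Q]) (simp add: simps opp_eq)
  next
    case 4
    then show ?thesis
      using Y f by (simp add: cross_from_da[OF Q]) (simp add: simps opp_eq)
  qed
qed

text \<open>
  Rotation brings the edge with the exceptional direction to the front.  If it is outgoing, the rule
  is the definition of \<^const>\<open>vert\<close>; if it is incoming, all three edges are reversed, which \<open>mul_opp\<close>
  allows.
\<close>

lemma obeys_rule_Vertex:
  assumes Y: "Y_oriented_node (Vertex a b c)"
    and f: "f (fst a) \<in> Q" "f (fst b) \<in> Q" "f (fst c) \<in> Q"
  shows "obeys_rule un ov mul f (Vertex a b c) \<longleftrightarrow>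
    vert (toward f a) (toward f b) (toward f c)"
proof -
  have main: "(case right_left_third_at t u v of (r, l, t) \<Rightarrow> mul (f r) (f l) (f t)) \<longleftrightarrow>
      vert (toward f t) (toward f u) (toward f v)"
    if "snd u = snd v" "snd t \<noteq> snd u" "f (fst t) \<in> Q" "f (fst u) \<in> Q" "f (fst v) \<in> Q" for t u v
  proof -
    \<comment> \<open>the rule for an outgoing \<open>t\<close> reads \<open>mul v u t\<close>, so \<open>t\<close> has to come last\<close>
    have rot: "vert (toward f t) (toward f u) (toward f v) \<longleftrightarrow>
        vert (toward f u) (toward f v) (toward f t)"
      using that by (intro vert_rotate) (auto simp: toward_def closed)
    have "mul x y z" if "mul (opp y) (opp x) (opp z)" "x \<in> Q" "y \<in> Q" "z \<in> Q" for x y z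
      using mul_opp[OF that(1)] that by (simp add: opp_opp closed)
    then have "mul (opp y) (opp x) (opp z) \<longleftrightarrow> mul x y z" if "x \<in> Q" "y \<in> Q" "z \<in> Q" for x y z
      using mul_opp that by blast
    then show ?thesis
      unfolding rot using that by (auto simp: right_left_third_at_def vert_def toward_def opp_opp)
  qed
  have Q: "toward f a \<in> Q" "toward f b \<in> Q" "toward f c \<in> Q"
    using f by (auto simp: toward_def closed)
  show ?thesis
    using Y f main[of b c a] main[of c a b] main[of a b c] vert_rotate[OF Q]
      vert_rotate[of "toward f b" "toward f c" "toward f a"] Q
    by (auto simp: right_left_third_def)
qed

section \<open>Algebraic form of the moves\<close>

text \<open>
  The map \<open>x \<mapsto> opp (x \<rightharpoondown> x)\<close> is an involution by \<open>opp_square\<close>.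
\<close>

lemma square_eq_opp:
  assumes "x \<in> Q" "y \<in> Q"
  shows "x \<rightharpoondown> x = opp y \<longleftrightarrow> x = opp (y \<rightharpoondown> y)"
  using assms opp_square by (metis opp_opp un_closed opp_closed)

text \<open>
  A kink has the two ends of one semiarc at neighboring places of its crossing, so solving from these
  two places makes both remaining colors the square of \<open>e\<close>, up to direction.  Hence the strand keeps its color
  and \<open>e\<close> is the root of a square.
\<close>

lemma kink_left:
  assumes "p \<in> Q" "q \<in> Q" "e \<in> Q"
  shows "cross p q e (opp e) \<longleftrightarrow> p = opp q \<and> e = opp (p \<rightharpoondown> p)"
proof -
  have "cross p q e (opp e) \<longleftrightarrow> p = opp (e \<rightharpoondown> e) \<and> q = e \<rightharpoondown> e"
    using assms by (simp add: cross_from_cd opp_opp closed un_self)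
  also have "\<dots> \<longleftrightarrow> p = opp q \<and> e \<rightharpoondown> e = opp p"
    using assms by (metis opp_opp un_closed)
  finally show ?thesis
    using assms by (simp add: square_eq_opp)
qed

lemma kink_right:
  assumes "p \<in> Q" "q \<in> Q" "e \<in> Q"
  shows "cross e p q (opp e) \<longleftrightarrow> p = opp q \<and> e = p \<rightharpoondown> p"
proof -
  have "cross e p q (opp e) \<longleftrightarrow> q = opp e \<rightharpoondown> opp e \<and> p = opp (opp e \<rightharpoondown> opp e)"
    using assms by (simp add: cross_from_da opp_opp closed un_self)
  also have "\<dots> \<longleftrightarrow> p = opp q \<and> opp e \<rightharpoondown> opp e = opp p"
    using assms by (metis opp_opp un_closed)
  finally show ?thesis
    using assms by (simp add: square_eq_opp closed) (metis opp_opp un_closed)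
qed

text \<open>
  In a clasp the second crossing sees the first one in a mirror: both are solved from the shared
  semiarcs \<open>e\<close>, \<open>f\<close>, with the same result up to direction.
\<close>

lemma cross_clasp:
  assumes "q \<in> Q" "e \<in> Q" "f \<in> Q" "p \<in> Q" "r \<in> Q" "t \<in> Q" "cross q e f p"
  shows "cross r t (opp f) (opp e) \<longleftrightarrow> p = opp t \<and> q = opp r"
proof -
  have "q = opp f \<rightharpoondown> e" "p = opp (e \<rightharpoonup> opp f)"
    using assms by (auto simp: cross_from_bc)
  then have "cross r t (opp f) (opp e) \<longleftrightarrow> r = opp q \<and> t = opp p"
    using assms(1-6) by (simp add: cross_from_cd opp_opp closed)
  then show ?thesis
    using assms by (metis opp_opp)
qed

text \<open>
  The inner semiarcs of one side, suitably directed, carry colors \<open>x\<close> (bottom strand), \<open>y\<close> and \<open>z\<close> (top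
  strand), and its three crossings express the six boundary colors by one operation each.  An inner
  semiarc of the other side meets two of the crossings there, which compute its color in two
  ways from the boundary; the three exchange laws say that the results agree.
\<close>

lemma cross_R3_a:
  assumes Q: "a \<in> Q" "b \<in> Q" "c \<in> Q" "p0 \<in> Q" "p1 \<in> Q" "p2 \<in> Q" "p3 \<in> Q" "p4 \<in> Q" "p5 \<in> Q"
    and c: "cross p1 a b p0" "cross p2 p3 c (opp a)" "cross (opp c) p4 p5 (opp b)"
  shows "\<exists>a'\<in>Q. \<exists>b'\<in>Q. \<exists>c'\<in>Q. cross c' a' p5 p0 \<and> cross b' p3 p4 (opp a') \<and>
    cross p2 (opp b') (opp c') p1"
proof -
  define x y z where "x = c" and "y = opp b" and "z = a"
  note xyz = x_def y_def z_def
  have [simp]: "x \<in> Q" "y \<in> Q" "z \<in> Q"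
    using Q by (auto simp: xyz closed)
  have p1: "p1 = y \<rightharpoondown> z" and p0: "p0 = opp (z \<rightharpoonup> y)"
    using c(1) Q by (auto simp: xyz cross_from_bc)
  have p2: "p2 = opp (x \<rightharpoondown> z)" and p3: "p3 = z \<rightharpoonup> x"
    using c(2) Q by (auto simp: xyz cross_from_cd closed opp_opp)
  have p5: "p5 = x \<rightharpoondown> y" and p4: "p4 = opp (y \<rightharpoonup> x)"
    using c(3) Q by (auto simp: xyz cross_from_da closed opp_opp)
  define a' b' c' where "a' = (z \<rightharpoonup> x) \<rightharpoonup> (y \<rightharpoonup> x)" and "b' = (y \<rightharpoonup> x) \<rightharpoondown> (z \<rightharpoonup> x)"
    and "c' = opp ((x \<rightharpoondown> y) \<rightharpoondown> (z \<rightharpoonup> y))"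
  have [simp]: "a' \<in> Q" "b' \<in> Q" "c' \<in> Q"
    by (auto simp: a'_def b'_def c'_def closed)
  have "cross c' a' p5 p0"
    using Q by (simp add: cross_from_cd) (simp add: p5 p0 c'_def a'_def opp_opp closed exchange_ov_ov)
  moreover have "cross b' p3 p4 (opp a')"
    using Q by (simp add: cross_from_bc closed) (simp add: p3 p4 b'_def a'_def opp_opp closed)
  moreover have "cross p2 (opp b') (opp c') p1"
    using Q by (simp add: cross_from_da closed)
      (simp add: p2 p1 b'_def c'_def opp_opp closed exchange_un_un exchange_ov_un)
  ultimately show ?thesis
    by (meson \<open>a' \<in> Q\<close> \<open>b' \<in> Q\<close> \<open>c' \<in> Q\<close>)
qed

text \<open>
  Here \<open>x\<close> and \<open>y\<close> trade places: the strand of \<open>b\<close> is at the bottom and that of \<open>c\<close> in the middle.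
\<close>

lemma cross_R3_b:
  assumes Q: "a \<in> Q" "b \<in> Q" "c \<in> Q" "p0 \<in> Q" "p1 \<in> Q" "p2 \<in> Q" "p3 \<in> Q" "p4 \<in> Q" "p5 \<in> Q"
    and c: "cross p1 a b p0" "cross p2 p3 c (opp a)" "cross (opp b) (opp c) p4 p5"
  shows "\<exists>a'\<in>Q. \<exists>b'\<in>Q. \<exists>c'\<in>Q. cross c' a' p5 p0 \<and> cross b' p3 p4 (opp a') \<and>
    cross p1 p2 (opp b') (opp c')"
proof -
  define x y z where "x = opp b" and "y = c" and "z = a"
  note xyz = x_def y_def z_def
  have [simp]: "x \<in> Q" "y \<in> Q" "z \<in> Q"
    using Q by (auto simp: xyz closed)
  have p1: "p1 = x \<rightharpoondown> z" and p0: "p0 = opp (z \<rightharpoonup> x)"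
    using c(1) Q by (auto simp: xyz cross_from_bc)
  have p2: "p2 = opp (y \<rightharpoondown> z)" and p3: "p3 = z \<rightharpoonup> y"
    using c(2) Q by (auto simp: xyz cross_from_cd closed opp_opp)
  have p4: "p4 = opp (x \<rightharpoondown> y)" and p5: "p5 = y \<rightharpoonup> x"
    using c(3) Q by (auto simp: xyz cross_from_ab closed opp_opp)
  define a' b' c' where "a' = (z \<rightharpoonup> x) \<rightharpoonup> (y \<rightharpoonup> x)" and "b' = (x \<rightharpoondown> y) \<rightharpoondown> (z \<rightharpoonup> y)"
    and "c' = opp ((y \<rightharpoonup> x) \<rightharpoondown> (z \<rightharpoonup> x))"
  have [simp]: "a' \<in> Q" "b' \<in> Q" "c' \<in> Q"
    by (auto simp: a'_def b'_def c'_def closed)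
  have "cross c' a' p5 p0"
    using Q by (simp add: cross_from_cd) (simp add: p5 p0 c'_def a'_def opp_opp closed)
  moreover have "cross b' p3 p4 (opp a')"
    using Q by (simp add: cross_from_bc closed)
      (simp add: p3 p4 b'_def a'_def opp_opp closed exchange_ov_ov)
  moreover have "cross p1 p2 (opp b') (opp c')"
    using Q by (simp add: cross_from_ab closed)
      (simp add: p2 p1 b'_def c'_def opp_opp closed exchange_un_un exchange_ov_un)
  ultimately show ?thesis
    by (meson \<open>a' \<in> Q\<close> \<open>b' \<in> Q\<close> \<open>c' \<in> Q\<close>)
qed

text \<open>
  A half turn of the disc exchanges the two sides of the third Reidemeister move, so the inverse
  move is the move itself with boundary positions shifted by three.
\<close>

lemma cross_R3_a_inverse:
  assumes Q: "a \<in> Q" "b \<in> Q" "c \<in> Q" "p0 \<in> Q" "p1 \<in> Q" "p2 \<in> Q" "p3 \<in> Q" "p4 \<in> Q" "p5 \<in> Q"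
    and c: "cross c a p5 p0" "cross b p3 p4 (opp a)" "cross p2 (opp b) (opp c) p1"
  shows "\<exists>a'\<in>Q. \<exists>b'\<in>Q. \<exists>c'\<in>Q. cross p1 a' b' p0 \<and> cross p2 p3 c' (opp a') \<and>
    cross (opp c') p4 p5 (opp b')"
proof -
  have "cross p4 (opp a) b p3" "cross p5 p0 c (opp (opp a))" "cross (opp c) p1 p2 (opp b)"
    using c Q cross_rotate by (auto simp: closed opp_opp)
  then obtain a' b' c' where *: "a' \<in> Q" "b' \<in> Q" "c' \<in> Q"
    "cross c' a' p2 p3" "cross b' p0 p1 (opp a')" "cross p5 (opp b') (opp c') p4"
    using cross_R3_a[of "opp a" b c p3 p4 p5 p0 p1 p2] Q by (auto simp: closed)
  then have "cross p1 (opp a') b' p0" "cross p2 p3 c' (opp (opp a'))" "cross (opp c') p4 p5 (opp b')"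
    using Q cross_rotate by (auto simp: closed opp_opp)
  then show ?thesis
    using * opp_closed by blast
qed

lemma cross_R3_b_inverse:
  assumes Q: "a \<in> Q" "b \<in> Q" "c \<in> Q" "p0 \<in> Q" "p1 \<in> Q" "p2 \<in> Q" "p3 \<in> Q" "p4 \<in> Q" "p5 \<in> Q"
    and c: "cross c a p5 p0" "cross b p3 p4 (opp a)" "cross p1 p2 (opp b) (opp c)"
  shows "\<exists>a'\<in>Q. \<exists>b'\<in>Q. \<exists>c'\<in>Q. cross p1 a' b' p0 \<and> cross p2 p3 c' (opp a') \<and>
    cross (opp b') (opp c') p4 p5"
proof -
  have "cross p4 (opp a) b p3" "cross p5 p0 c (opp (opp a))" "cross (opp b) (opp c) p1 p2"
    using c Q cross_rotate by (auto simp: closed opp_opp)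
  then obtain a' b' c' where *: "a' \<in> Q" "b' \<in> Q" "c' \<in> Q"
    "cross c' a' p2 p3" "cross b' p0 p1 (opp a')" "cross p4 p5 (opp b') (opp c')"
    using cross_R3_b[of "opp a" b c p3 p4 p5 p0 p1 p2] Q by (auto simp: closed)
  then have "cross p1 (opp a') b' p0" "cross p2 p3 c' (opp (opp a'))" "cross (opp b') (opp c') p4 p5"
    using Q cross_rotate by (auto simp: closed opp_opp)
  then show ?thesis
    using * opp_closed by blast
qed

text \<open>
  On one side of the vertex the strand crosses the edge with the product \<open>y \<cdot> x\<close>, on the other side the
  two factors in turn: \<open>mul_un\<close> compares the effects on the edges and \<open>ov_mul\<close> those on the strand.
\<close>

lemma strand_over_vert:
  assumes Q: "x \<in> Q" "y \<in> Q" "e \<in> Q" "t \<in> Q" "z \<in> Q" "s \<in> Q"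
    and c: "vert x y e" "cross (opp e) t z s"
  shows "\<exists>a\<in>Q. \<exists>b\<in>Q. \<exists>m\<in>Q. vert a b z \<and> cross x m (opp a) s \<and> cross y t (opp b) (opp m)"
proof -
  define m where "m = opp (opp t \<rightharpoonup> y)"
  define a where "a = x \<rightharpoondown> opp m"
  define b where "b = y \<rightharpoondown> opp t"
  have [simp]: "a \<in> Q" "b \<in> Q" "m \<in> Q" and om: "opp m = opp t \<rightharpoonup> y"
    using Q by (auto simp: a_def b_def m_def closed opp_opp)
  have yx: "mul y x (opp e)"
    using c by (simp add: vert_def)
  have z: "opp z = opp e \<rightharpoondown> opp t" and s: "s = opp t \<rightharpoonup> opp e"
    using c Q by (auto simp: cross_from_ab closed opp_opp)
  have "vert a b z"
    using mul_un[OF yx, of "opp t"] Q by (simp add: vert_def z a_def b_def om closed)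
  moreover have "cross x m (opp a) s"
    using Q ov_mul[OF yx, of "opp t"] by (simp add: cross_from_ab closed s om) (simp add: a_def om)
  moreover have "cross y t (opp b) (opp m)"
    using Q by (simp add: cross_from_ab closed) (simp add: b_def om)
  ultimately show ?thesis
    using \<open>a \<in> Q\<close> \<open>b \<in> Q\<close> \<open>m \<in> Q\<close> by blast
qed

text \<open>
  The same laws applied to the product of \<open>b\<close> and \<open>a\<close>, with the moving strand reversed.
\<close>

lemma strand_over_vert_inverse:
  assumes Q: "x \<in> Q" "y \<in> Q" "t \<in> Q" "z \<in> Q" "s \<in> Q" "a \<in> Q" "b \<in> Q" "m \<in> Q"
    and c: "vert a b z" "cross x m (opp a) s" "cross y t (opp b) (opp m)"
  shows "\<exists>e\<in>Q. vert x y e \<and> cross (opp e) t z s"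
proof -
  define e where "e = opp (opp z \<rightharpoondown> t)"
  have [simp]: "e \<in> Q" and oe: "opp e = opp z \<rightharpoondown> t"
    using Q by (auto simp: e_def closed opp_opp)
  have ba: "mul b a (opp z)"
    using c by (simp add: vert_def)
  have y: "y = b \<rightharpoondown> t" and m: "m = t \<rightharpoonup> b"
    using c(3) Q by (auto simp: cross_from_bc closed opp_opp) (metis opp_opp ov_closed)
  have x: "x = a \<rightharpoondown> m" and s: "s = opp (m \<rightharpoonup> a)"
    using c(2) Q by (auto simp: cross_from_bc closed opp_opp)
  have "vert x y e"
    using mul_un[OF ba, of t] Q by (simp add: vert_def x y oe m)
  moreover have "cross (opp e) t z s"
    using Q ov_mul[OF ba, of t] by (simp add: cross_from_bc closed) (simp add: oe s m)
  ultimately show ?thesis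
    using \<open>e \<in> Q\<close> by blast
qed

lemma strand_under_vert:
  assumes Q: "x \<in> Q" "y \<in> Q" "e \<in> Q" "t \<in> Q" "z \<in> Q" "s \<in> Q"
    and c: "vert x y e" "cross s (opp e) t z"
  shows "\<exists>a\<in>Q. \<exists>b\<in>Q. \<exists>m\<in>Q. vert a b z \<and> cross s x m (opp a) \<and> cross (opp m) y t (opp b)"
proof -
  define m where "m = opp (opp t \<rightharpoondown> y)"
  define a where "a = x \<rightharpoonup> opp m"
  define b where "b = y \<rightharpoonup> opp t"
  have [simp]: "a \<in> Q" "b \<in> Q" "m \<in> Q" and om: "opp m = opp t \<rightharpoondown> y"
    using Q by (auto simp: a_def b_def m_def closed opp_opp)
  have yx: "mul y x (opp e)"
    using c by (simp add: vert_def)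
  have z: "opp z = opp e \<rightharpoonup> opp t" and s: "s = opp t \<rightharpoondown> opp e"
    using c Q by (auto simp: cross_from_bc closed opp_opp)
  have "vert a b z"
    using mul_ov[OF yx, of "opp t"] Q by (simp add: vert_def z a_def b_def om closed)
  moreover have "cross s x m (opp a)"
    using Q un_mul[OF yx, of "opp t"] by (simp add: cross_from_bc closed s om) (simp add: a_def om)
  moreover have "cross (opp m) y t (opp b)"
    using Q by (simp add: cross_from_bc closed) (simp add: b_def om)
  ultimately show ?thesis
    using \<open>a \<in> Q\<close> \<open>b \<in> Q\<close> \<open>m \<in> Q\<close> by blast
qed

lemma strand_under_vert_inverse:
  assumes Q: "x \<in> Q" "y \<in> Q" "t \<in> Q" "z \<in> Q" "s \<in> Q" "a \<in> Q" "b \<in> Q" "m \<in> Q"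
    and c: "vert a b z" "cross s x m (opp a)" "cross (opp m) y t (opp b)"
  shows "\<exists>e\<in>Q. vert x y e \<and> cross s (opp e) t z"
proof -
  define e where "e = opp (opp z \<rightharpoonup> t)"
  have [simp]: "e \<in> Q" and oe: "opp e = opp z \<rightharpoonup> t"
    using Q by (auto simp: e_def closed opp_opp)
  have ba: "mul b a (opp z)"
    using c by (simp add: vert_def)
  have y: "y = b \<rightharpoonup> t" and m: "m = t \<rightharpoondown> b"
    using c(3) Q by (auto simp: cross_from_cd closed opp_opp) (metis opp_opp un_closed)
  have x: "x = a \<rightharpoonup> m" and s: "s = opp (m \<rightharpoondown> a)"
    using c(2) Q by (auto simp: cross_from_cd closed opp_opp)
  have "vert x y e"
    using mul_ov[OF ba, of t] Q by (simp add: vert_def x y oe m)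
  moreover have "cross s (opp e) t z"
    using Q un_mul[OF ba, of t] by (simp add: cross_from_cd closed) (simp add: oe s m)
  ultimately show ?thesis
    using \<open>e \<in> Q\<close> by blast
qed

text \<open>
  Crossing two edges at a vertex replaces the product \<open>b \<cdot> a\<close> by the product of the conjugate of one
  factor with the other factor, and the swap laws keep its value.  Undoing one twist uses the swap
  law of the other.
\<close>

lemma untwist_a:
  assumes Q: "a \<in> Q" "b \<in> Q" "p \<in> Q" "q \<in> Q" "z \<in> Q"
    and c: "vert a b z" "cross (opp a) p q (opp b)"
  shows "vert p q z"
proof -
  have "q = a \<rightharpoondown> opp b" "p = opp (opp b \<rightharpoonup> a)"
    using c Q by (auto simp: cross_from_da closed opp_opp)
  then show ?thesis
    using c mul_swap_un[of b a "opp z"] opp_ov[of "opp b" a] Q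
    by (simp add: vert_def closed opp_opp)
qed

lemma twist_a:
  assumes Q: "p \<in> Q" "q \<in> Q" "z \<in> Q" and c: "vert p q z"
  shows "\<exists>a\<in>Q. \<exists>b\<in>Q. vert a b z \<and> cross (opp a) p q (opp b)"
proof -
  define b where "b = p \<rightharpoonup> opp q"
  define a where "a = q \<rightharpoondown> b"
  have [simp]: "a \<in> Q" "b \<in> Q"
    using Q by (auto simp: a_def b_def closed)
  have "vert a b z"
    using mul_swap_ov[of q p "opp z"] c Q by (simp add: vert_def a_def b_def)
  moreover have "cross (opp a) p q (opp b)"
    using Q opp_un[of q b] opp_un[of "opp q" p] ov_opp[of p "opp q"]
    by (simp add: cross_from_bc closed) (simp add: a_def b_def closed opp_opp)
  ultimately show ?thesis
    using \<open>a \<in> Q\<close> \<open>b \<in> Q\<close> by blast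
qed

lemma untwist_b:
  assumes Q: "a \<in> Q" "b \<in> Q" "p \<in> Q" "q \<in> Q" "z \<in> Q"
    and c: "vert a b z" "cross (opp b) (opp a) p q"
  shows "vert p q z"
proof -
  have "p = opp (opp b \<rightharpoondown> a)" "q = a \<rightharpoonup> opp b"
    using c Q by (auto simp: cross_from_ab closed opp_opp)
  then show ?thesis
    using c mul_swap_ov[of b a "opp z"] opp_un[of "opp b" a] Q
    by (simp add: vert_def closed opp_opp)
qed

lemma twist_b:
  assumes Q: "p \<in> Q" "q \<in> Q" "z \<in> Q" and c: "vert p q z"
  shows "\<exists>a\<in>Q. \<exists>b\<in>Q. vert a b z \<and> cross (opp b) (opp a) p q"
proof -
  define b where "b = p \<rightharpoondown> opp q"
  define a where "a = q \<rightharpoonup> b"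
  have [simp]: "a \<in> Q" "b \<in> Q"
    using Q by (auto simp: a_def b_def closed)
  have "vert a b z"
    using mul_swap_un[of q p "opp z"] c Q by (simp add: vert_def a_def b_def)
  moreover have "cross (opp b) (opp a) p q"
    using Q opp_ov[of q b] opp_ov[of "opp q" p] un_opp[of p "opp q"]
    by (simp add: cross_from_cd closed) (simp add: a_def b_def closed opp_opp)
  ultimately show ?thesis
    using \<open>a \<in> Q\<close> \<open>b \<in> Q\<close> by blast
qed

text \<open>
  The condition at the two vertices is that the product of the four boundary colors in cyclic order
  is trivial, bracketed in one way; associativity rebrackets it.
\<close>

lemma vert_IH:
  assumes Q: "a \<in> Q" "b \<in> Q" "c \<in> Q" "d \<in> Q" "e \<in> Q"
    and c: "vert a b e" "vert c d (opp e)"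
  shows "\<exists>f\<in>Q. vert b c f \<and> vert d a (opp f)"
proof -
  have "vert d (opp e) c"
    using c Q vert_rotate[of c d "opp e"] by (simp add: closed)
  then obtain u where u: "u \<in> Q" "mul a d u" "mul b u (opp c)"
    using mul_assoc[of b a "opp e" d "opp c"] c Q by (auto simp: vert_def closed)
  then have "vert u b c"
    by (simp add: vert_def)
  then have "vert b c u" "vert d a (opp u)"
    using u Q vert_rotate by (auto simp: vert_def opp_opp)
  then show ?thesis using u by blast
qed

lemma vert_unique:
  assumes "vert x y e" "vert x y e'" "e \<in> Q" "e' \<in> Q"
  shows "e = e'"
  using assms mul_functional opp_opp unfolding vert_def by metis

end

section \<open>Colorings inside a disc\<close>

text \<open>
  What a \<open>Y\<close>-oriented diagram says about the part of it inside a disc: \<open>S\<close> are the semiarcs that are not inner,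
  among them those that leave the disc.
\<close>

definition tangle :: "nat set \<Rightarrow> nat set \<Rightarrow> dart node multiset \<Rightarrow> bool" where
  "tangle S I T \<longleftrightarrow> S \<inter> I = {} \<and> (\<forall>n\<in>#T. Y_oriented_node n) \<and>
     (\<forall>d. count (\<Sum>n\<in>#T. node_darts n) d \<le> 1) \<and>
     (\<forall>d\<in>#(\<Sum>n\<in>#T. node_darts n). fst d \<in> S \<union> I)"

fun both_darts :: "nat list \<Rightarrow> dart multiset" where
  "both_darts [] = {#}"
| "both_darts (e # es) = {#(e, True), (e, False)#} + both_darts es"

lemma count_both_darts: "count (both_darts es) (e, s) = count (mset es) e"
  by (induction es) (cases s; auto)+

lemma tangle_disjoint: "tangle S I T \<Longrightarrow> S \<inter> I = {}"
  by (simp add: tangle_def)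

text \<open>
  Darts occur at most once, so once both ends of every inner semiarc are listed, the
  remaining darts \<open>B\<close> must be ends of semiarcs that leave the disc.
\<close>

lemma tangle_boundary:
  assumes T: "tangle S I T" and I: "I = set es"
    and B: "(\<Sum>n\<in>#T. node_darts n) = both_darts es + B"
  shows "distinct es" and "\<forall>d\<in>#B. fst d \<in> S"
proof -
  have le: "count (both_darts es) d + count B d \<le> 1" for d
    using T unfolding tangle_def B by (metis count_union)
  have "count (mset es) e \<le> 1" for e
    using le[of "(e, True)"] by (simp add: count_both_darts)
  then show "distinct es"
    unfolding distinct_count_atmost_1
    by (metis One_nat_def count_greater_zero_iff count_mset_0_iff le_antisym le_neq_implies_less less_one set_mset_mset Suc_leI)
  show "\<forall>d\<in>#B. fst d \<in> S"
  proof
    fix d assume d: "d \<in># B"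
    then have "1 \<le> count B d"
      by (simp add: Suc_leI)
    then have "count (both_darts es) d = 0"
      using le[of d] by linarith
    then have "fst d \<notin> I"
      unfolding I by (cases d) (simp add: count_both_darts)
    then show "fst d \<in> S"
      using T d unfolding tangle_def B by auto
  qed
qed

context reversible_biquandle
begin

text \<open>
  The form of the coloring rules that does not mention directions.
\<close>

fun dart_rule :: "(nat \<Rightarrow> 'q) \<Rightarrow> dart node \<Rightarrow> bool" where
  "dart_rule f (Crossing a b c d) \<longleftrightarrow>
     cross (toward f a) (toward f b) (toward f c) (toward f d)"
| "dart_rule f (Vertex a b c) \<longleftrightarrow> vert (toward f a) (toward f b) (toward f c)"

lemma obeys_rule_iff_dart_rule:
  assumes "Y_oriented_node n" "\<And>d. d \<in># node_darts n \<Longrightarrow> f (fst d) \<in> Q"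
  shows "obeys_rule un ov mul f n \<longleftrightarrow> dart_rule f n"
proof (cases n)
  case (Crossing a b c d)
  then show ?thesis
    using assms obeys_rule_Crossing[of a b c d f] by simp
next
  case (Vertex a b c)
  then show ?thesis
    using assms obeys_rule_Vertex[of a b c f] by simp
qed

definition fills :: "nat set \<Rightarrow> nat set \<Rightarrow> dart node multiset \<Rightarrow> (nat \<Rightarrow> 'q) \<Rightarrow> bool" where
  "fills S I T f \<longleftrightarrow> (\<forall>e\<in>S \<union> I. f e \<in> Q) \<and> (\<forall>n\<in>#T. obeys_rule un ov mul f n)"

lemma fills_iff_dart_rule:
  assumes "tangle S I T"
  shows "fills S I T f \<longleftrightarrow> (\<forall>e\<in>S \<union> I. f e \<in> Q) \<and> (\<forall>n\<in>#T. dart_rule f n)"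
proof -
  have "obeys_rule un ov mul f n \<longleftrightarrow> dart_rule f n" if "n \<in># T" "\<forall>e\<in>S \<union> I. f e \<in> Q" for n
    using assms that by (intro obeys_rule_iff_dart_rule) (auto simp: tangle_def)
  then show ?thesis
    unfolding fills_def by blast
qed

text \<open>
  The color to be given to a semiarc \<open>e\<close> in order that its end \<open>(e, i)\<close> carries \<open>v\<close>.
\<close>

definition place :: "bool \<Rightarrow> 'q \<Rightarrow> 'q" where
  "place i v = (if i then v else opp v)"

lemma place_closed: "v \<in> Q \<Longrightarrow> place i v \<in> Q"
  by (simp add: place_def closed)

lemma toward_closed: "f (fst d) \<in> Q \<Longrightarrow> toward f d \<in> Q"
  by (simp add: toward_def closed)

lemma toward_Not: "f e \<in> Q \<Longrightarrow> toward f (e, \<not> i) = opp (toward f (e, i))"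
  by (auto simp: toward_def opp_opp)

lemma toward_place: "v \<in> Q \<Longrightarrow> toward (f(e := place i v)) (e, i) = v"
  by (auto simp: toward_def place_def opp_opp)

lemma toward_place_Not: "v \<in> Q \<Longrightarrow> toward (f(e := place i v)) (e, \<not> i) = opp v"
  by (auto simp: toward_def place_def opp_opp)

lemma toward_other: "fst d \<noteq> e \<Longrightarrow> toward (f(e := v)) d = toward f d"
  by (simp add: toward_def)

lemma toward_glue:
  assumes "f (fst p) \<in> Q" "f (fst q) \<in> Q" "snd p \<noteq> snd q"
  shows "toward f p = opp (toward f q) \<longleftrightarrow> f (fst p) = f (fst q)"
  using assms by (auto simp: toward_def opp_opp) (metis opp_opp)+

text \<open>
  The coloring inside the disc can be exchanged without changing the colors outside.  The lists
  \<open>w\<close> and \<open>w'\<close> demand equal colors on the semiarcs that are to be joined when the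
  side in question consists of strands without crossings.
\<close>

definition extends_to :: "nat set \<Rightarrow> nat set \<Rightarrow> dart node multiset \<Rightarrow> (nat \<times> nat) list \<Rightarrow>
    nat set \<Rightarrow> dart node multiset \<Rightarrow> (nat \<times> nat) list \<Rightarrow> bool" where
  "extends_to S I T w I' T' w' \<longleftrightarrow>
     (\<forall>f. fills S I T f \<and> (\<forall>(x, y)\<in>set w. f x = f y) \<longrightarrow>
       (\<exists>g. (\<forall>s\<in>S. g s = f s) \<and> fills S I' T' g \<and> (\<forall>(x, y)\<in>set w'. g x = g y)))"

definition determined :: "nat set \<Rightarrow> nat set \<Rightarrow> dart node multiset \<Rightarrow> bool" where
  "determined S I T \<longleftrightarrow> (\<forall>f g. fills S I T f \<and> fills S I T g \<and> (\<forall>s\<in>S. f s = g s) \<longrightarrow>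
     (\<forall>e\<in>I. f e = g e))"

text \<open>
  With \<open>P\<close> read as ``the color of this end is determined'', this is how determination spreads at a
  node: from two neighboring ends to all ends.
\<close>

fun propagates :: "(dart \<Rightarrow> bool) \<Rightarrow> dart node \<Rightarrow> bool" where
  "propagates P (Crossing a b c d) \<longleftrightarrow>
     (P a \<and> P b \<longrightarrow> P c \<and> P d) \<and> (P b \<and> P c \<longrightarrow> P d \<and> P a) \<and>
     (P c \<and> P d \<longrightarrow> P a \<and> P b) \<and> (P d \<and> P a \<longrightarrow> P b \<and> P c)"
| "propagates P (Vertex a b c) \<longleftrightarrow>
     (P a \<and> P b \<longrightarrow> P c) \<and> (P b \<and> P c \<longrightarrow> P a) \<and> (P c \<and> P a \<longrightarrow> P b)"

lemma propagates_agreement: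
  assumes f: "dart_rule f n" and g: "dart_rule g n"
    and Qf: "\<And>d. d \<in># node_darts n \<Longrightarrow> toward f d \<in> Q"
    and Qg: "\<And>d. d \<in># node_darts n \<Longrightarrow> toward g d \<in> Q"
  shows "propagates (\<lambda>d. toward f d = toward g d) n"
proof (cases n)
  case (Crossing a b c d)
  then have Q: "toward f a \<in> Q" "toward f b \<in> Q" "toward f c \<in> Q" "toward f d \<in> Q"
    "toward g a \<in> Q" "toward g b \<in> Q" "toward g c \<in> Q" "toward g d \<in> Q"
    using Qf Qg by auto
  note f' = f[unfolded Crossing dart_rule.simps] and g' = g[unfolded Crossing dart_rule.simps]
  show ?thesis
    unfolding Crossing propagates.simps
    using f'[unfolded cross_from_ab[OF Q(1-4)]] g'[unfolded cross_from_ab[OF Q(5-8)]]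
      f'[unfolded cross_from_bc[OF Q(1-4)]] g'[unfolded cross_from_bc[OF Q(5-8)]]
      f'[unfolded cross_from_cd[OF Q(1-4)]] g'[unfolded cross_from_cd[OF Q(5-8)]]
      f'[unfolded cross_from_da[OF Q(1-4)]] g'[unfolded cross_from_da[OF Q(5-8)]]
    by (intro conjI impI) (elim conjE; argo)+
next
  case (Vertex a b c)
  then have Q: "toward f a \<in> Q" "toward f b \<in> Q" "toward f c \<in> Q"
    "toward g a \<in> Q" "toward g b \<in> Q" "toward g c \<in> Q"
    using Qf Qg by auto
  have "vert (toward f a) (toward f b) (toward f c)" "vert (toward g a) (toward g b) (toward g c)"
    using f g Vertex by auto
  then show ?thesis
    unfolding Vertex propagates.simps using vert_unique vert_rotate Q by metis
qed

text \<open>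
  Uniqueness inside the disc becomes propositional reasoning, with \<open>P\<close> instantiated to agreement of
  two colorings.
\<close>

lemma determinedI:
  assumes T: "tangle S I T"
    and *: "\<And>P. \<lbrakk>\<And>d. fst d \<in> S \<Longrightarrow> P d; \<And>e. e \<in> I \<Longrightarrow> P (e, False) \<longleftrightarrow> P (e, True);
      \<forall>n\<in>#T. propagates P n\<rbrakk> \<Longrightarrow> \<forall>e\<in>I. P (e, True)"
  shows "determined S I T"
  unfolding determined_def fills_iff_dart_rule[OF T]
proof (intro allI impI)
  fix f g
  assume fg: "((\<forall>e\<in>S \<union> I. f e \<in> Q) \<and> (\<forall>n\<in>#T. dart_rule f n)) \<and>
    ((\<forall>e\<in>S \<union> I. g e \<in> Q) \<and> (\<forall>n\<in>#T. dart_rule g n)) \<and> (\<forall>s\<in>S. f s = g s)"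
  have "\<forall>e\<in>I. toward f (e, True) = toward g (e, True)"
  proof (rule *)
    show "toward f d = toward g d" if "fst d \<in> S" for d
      using fg that by (simp add: toward_def)
    show "toward f (e, False) = toward g (e, False) \<longleftrightarrow> toward f (e, True) = toward g (e, True)"
      if "e \<in> I" for e
      using fg that by (auto simp: toward_def) (metis UnI2 opp_opp)
    show "\<forall>n\<in>#T. propagates (\<lambda>d. toward f d = toward g d) n"
    proof
      fix n assume n: "n \<in># T"
      then have "fst d \<in> S \<union> I" if "d \<in># node_darts n" for d
        using T that unfolding tangle_def by auto
      then show "propagates (\<lambda>d. toward f d = toward g d) n"
        using fg n by (intro propagates_agreement) (auto intro!: toward_closed)
    qed
  qed
  then show "\<forall>e\<in>I. f e = g e"
    by (simp add: toward_def)
qed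

lemma extends_toI:
  assumes T: "tangle S I T" and T': "tangle S I' T'"
    and *: "\<And>f. \<lbrakk>\<forall>e\<in>S \<union> I. f e \<in> Q; \<forall>n\<in>#T. dart_rule f n; \<forall>(x, y)\<in>set w. f x = f y\<rbrakk> \<Longrightarrow>
      \<exists>g. (\<forall>s\<in>S. g s = f s) \<and> (\<forall>e\<in>I'. g e \<in> Q) \<and> (\<forall>n\<in>#T'. dart_rule g n) \<and>
        (\<forall>(x, y)\<in>set w'. g x = g y)"
  shows "extends_to S I T w I' T' w'"
  unfolding extends_to_def fills_iff_dart_rule[OF T] fills_iff_dart_rule[OF T']
proof (intro allI impI)
  fix f
  assume f: "((\<forall>e\<in>S \<union> I. f e \<in> Q) \<and> (\<forall>n\<in>#T. dart_rule f n)) \<and> (\<forall>(x, y)\<in>set w. f x = f y)"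
  then obtain g where g: "\<forall>s\<in>S. g s = f s" "\<forall>e\<in>I'. g e \<in> Q" "\<forall>n\<in>#T'. dart_rule g n"
    "\<forall>(x, y)\<in>set w'. g x = g y"
    using *[of f] by blast
  moreover have "\<forall>e\<in>S \<union> I'. g e \<in> Q"
    using f g by auto
  ultimately show "\<exists>g. (\<forall>s\<in>S. g s = f s) \<and> ((\<forall>e\<in>S \<union> I'. g e \<in> Q) \<and> (\<forall>n\<in>#T'. dart_rule g n)) \<and>
      (\<forall>(x, y)\<in>set w'. g x = g y)"
    by blast
qed

text \<open>
  Restriction to \<open>S\<close> is injective on the colorings of either side, and the two sides have the
  same restrictions.
\<close>

definition interchangeable :: "nat set \<Rightarrow> nat set \<Rightarrow> dart node multiset \<Rightarrow>
    nat set \<Rightarrow> dart node multiset \<Rightarrow> (nat \<times> nat) list \<Rightarrow> bool" where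
  "interchangeable S I T I' T' w \<longleftrightarrow> determined S I T \<and> determined S I' T' \<and>
     extends_to S I T [] I' T' w \<and> extends_to S I' T' w I T []"

text \<open>
  A quarter turn of the disc inverts the IH move.
\<close>

lemma vert_IH_inverse:
  assumes Q: "a \<in> Q" "b \<in> Q" "c \<in> Q" "d \<in> Q" "e \<in> Q"
    and c: "vert b c e" "vert d a (opp e)"
  shows "\<exists>f\<in>Q. vert a b f \<and> vert c d (opp f)"
proof -
  obtain f where "f \<in> Q" "vert c d f" "vert a b (opp f)"
    using vert_IH[of b c d a e] assms by blast
  then show ?thesis
    using Q by (intro bexI[of _ "opp f"]) (auto simp: opp_opp closed)
qed

section \<open>The moves inside a disc\<close>

lemma tangle_empty: "tangle S {} {#}"
  by (simp add: tangle_def)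

lemma tangle_Y: "tangle S I T \<Longrightarrow> n \<in># T \<Longrightarrow> Y_oriented_node n"
  by (simp add: tangle_def)

text \<open>
  From here on, one lemma for each move.  Agreement on the boundary spreads to all inner semiarcs of
  either side.  A coloring of one side is carried to the other by giving the new inner
  semiarcs the colors supplied by the algebraic lemma on that move.
\<close>

lemma interchangeable_R1_a:
  assumes T: "tangle S {e} {#Crossing p q (e, i) (e, \<not> i)#}" (is "tangle S ?I ?T")
  shows "interchangeable S ?I ?T {} {#} [(fst p, fst q)]"
proof -
  let ?B = "{#p, q#}"
  have B: "(\<Sum>n\<in>#?T. node_darts n) = both_darts [e] + ?B"
    by (cases i; simp)
  have p: "\<forall>d\<in>#?B. fst d \<in> S"
    by (rule tangle_boundary[OF T _ B], simp)
  have "e \<notin> S"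
    using tangle_disjoint[OF T] by blast
  then have ne: "fst d \<noteq> e" if "d \<in># ?B" for d
    using p that by blast
  have "snd p \<noteq> snd q"
    using tangle_Y[OF T, of "Crossing p q (e, i) (e, \<not> i)"] by auto
  then have glue: "toward f p = opp (toward f q) \<longleftrightarrow> f (fst p) = f (fst q)"
    if "\<forall>e\<in>S. f e \<in> Q" for f
    using p that by (intro toward_glue) auto
  have "determined S ?I ?T"
    using p by (intro determinedI[OF T]) (cases i; auto)
  moreover have "determined S {} {#}"
    by (simp add: determined_def)
  moreover have "extends_to S ?I ?T [] {} {#} [(fst p, fst q)]"
  proof (rule extends_toI[OF T tangle_empty])
    fix f assume Q: "\<forall>e\<in>S \<union> ?I. f e \<in> Q" and f: "\<forall>n\<in>#?T. dart_rule f n"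
    then have "f (fst p) = f (fst q)"
      using kink_left[of "toward f p" "toward f q" "toward f (e, i)"] p glue
      by (auto simp: toward_Not toward_closed)
    then show "\<exists>g. (\<forall>s\<in>S. g s = f s) \<and> (\<forall>e\<in>{}. g e \<in> Q) \<and> (\<forall>n\<in>#{#}. dart_rule g n) \<and>
      (\<forall>(x, y)\<in>set [(fst p, fst q)]. g x = g y)"
      by auto
  qed
  moreover have "extends_to S {} {#} [(fst p, fst q)] ?I ?T []"
  proof (rule extends_toI[OF tangle_empty T])
    fix f assume Q: "\<forall>e\<in>S \<union> {}. f e \<in> Q" and f: "\<forall>(x, y)\<in>set [(fst p, fst q)]. f x = f y"
    have "toward f p = opp (toward f q)" "toward f p \<in> Q" "toward f q \<in> Q"
      using Q f p glue by (auto simp: toward_closed)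
    moreover define v where "v = opp (toward f p \<rightharpoondown> toward f p)"
    ultimately have "v \<in> Q" "cross (toward f p) (toward f q) v (opp v)"
      using kink_left[of "toward f p" "toward f q" v] by (auto simp: closed)
    then show "\<exists>g. (\<forall>s\<in>S. g s = f s) \<and> (\<forall>e\<in>?I. g e \<in> Q) \<and> (\<forall>n\<in>#?T. dart_rule g n) \<and>
      (\<forall>(x, y)\<in>set []. g x = g y)"
      using \<open>e \<notin> S\<close>
      by (intro exI[of _ "f(e := place i v)"])
        (auto simp: toward_other ne toward_place toward_place_Not place_closed)
  qed
  ultimately show ?thesis
    unfolding interchangeable_def by blast
qed

lemma interchangeable_R1_b:
  assumes T: "tangle S {e} {#Crossing (e, i) p q (e, \<not> i)#}" (is "tangle S ?I ?T")
  shows "interchangeable S ?I ?T {} {#} [(fst p, fst q)]"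
proof -
  let ?B = "{#p, q#}"
  have B: "(\<Sum>n\<in>#?T. node_darts n) = both_darts [e] + ?B"
    by (cases i; simp)
  have p: "\<forall>d\<in>#?B. fst d \<in> S"
    by (rule tangle_boundary[OF T _ B], simp)
  have "e \<notin> S"
    using tangle_disjoint[OF T] by blast
  then have ne: "fst d \<noteq> e" if "d \<in># ?B" for d
    using p that by blast
  have "snd p \<noteq> snd q"
    using tangle_Y[OF T, of "Crossing (e, i) p q (e, \<not> i)"] by auto
  then have glue: "toward f p = opp (toward f q) \<longleftrightarrow> f (fst p) = f (fst q)"
    if "\<forall>e\<in>S. f e \<in> Q" for f
    using p that by (intro toward_glue) auto
  have "determined S ?I ?T"
    using p by (intro determinedI[OF T]) (cases i; auto)
  moreover have "determined S {} {#}"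
    by (simp add: determined_def)
  moreover have "extends_to S ?I ?T [] {} {#} [(fst p, fst q)]"
  proof (rule extends_toI[OF T tangle_empty])
    fix f assume Q: "\<forall>e\<in>S \<union> ?I. f e \<in> Q" and f: "\<forall>n\<in>#?T. dart_rule f n"
    then have "f (fst p) = f (fst q)"
      using kink_right[of "toward f p" "toward f q" "toward f (e, i)"] p glue
      by (auto simp: toward_Not toward_closed)
    then show "\<exists>g. (\<forall>s\<in>S. g s = f s) \<and> (\<forall>e\<in>{}. g e \<in> Q) \<and> (\<forall>n\<in>#{#}. dart_rule g n) \<and>
      (\<forall>(x, y)\<in>set [(fst p, fst q)]. g x = g y)"
      by auto
  qed
  moreover have "extends_to S {} {#} [(fst p, fst q)] ?I ?T []"
  proof (rule extends_toI[OF tangle_empty T])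
    fix f assume Q: "\<forall>e\<in>S \<union> {}. f e \<in> Q" and f: "\<forall>(x, y)\<in>set [(fst p, fst q)]. f x = f y"
    have "toward f p = opp (toward f q)" "toward f p \<in> Q" "toward f q \<in> Q"
      using Q f p glue by (auto simp: toward_closed)
    moreover define v where "v = toward f p \<rightharpoondown> toward f p"
    ultimately have "v \<in> Q" "cross v (toward f p) (toward f q) (opp v)"
      using kink_right[of "toward f p" "toward f q" v] by (auto simp: closed)
    then show "\<exists>g. (\<forall>s\<in>S. g s = f s) \<and> (\<forall>e\<in>?I. g e \<in> Q) \<and> (\<forall>n\<in>#?T. dart_rule g n) \<and>
      (\<forall>(x, y)\<in>set []. g x = g y)"
      using \<open>e \<notin> S\<close>
      by (intro exI[of _ "f(e := place i v)"])
        (auto simp: toward_other ne toward_place toward_place_Not place_closed)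
  qed
  ultimately show ?thesis
    unfolding interchangeable_def by blast
qed

text \<open>
  The colors of \<open>e\<close> and \<open>h\<close> are solved from the first crossing; the second one then holds because
  the joined semiarcs have equal colors.
\<close>

lemma interchangeable_R2:
  assumes T: "tangle S {e, h} {#Crossing q (e, i) (h, j) p, Crossing r t (h, \<not> j) (e, \<not> i)#}"
      (is "tangle S ?I ?T")
  shows "interchangeable S ?I ?T {} {#} [(fst p, fst t), (fst q, fst r)]"
proof -
  let ?B = "{#p, q, r, t#}"
  have B: "(\<Sum>n\<in>#?T. node_darts n) = both_darts [e, h] + ?B"
    by (cases i; cases j; simp)
  have d: "distinct [e, h]" and p: "\<forall>d\<in>#?B. fst d \<in> S"
    by (rule tangle_boundary[OF T _ B], simp)+
  have disj: "S \<inter> ?I = {}"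
    using T tangle_disjoint by blast
  then have ne: "fst d \<noteq> e" if "d \<in># ?B" "e \<in> ?I" for d e
    using p that by blast
  have "snd p \<noteq> snd t" "snd q \<noteq> snd r"
    using tangle_Y[OF T, of "Crossing q (e, i) (h, j) p"]
      tangle_Y[OF T, of "Crossing r t (h, \<not> j) (e, \<not> i)"] by auto
  then have glue: "toward f p = opp (toward f t) \<longleftrightarrow> f (fst p) = f (fst t)"
    "toward f q = opp (toward f r) \<longleftrightarrow> f (fst q) = f (fst r)"
    if "\<forall>e\<in>S. f e \<in> Q" for f
    using p that by (simp_all add: toward_glue)
  have "determined S ?I ?T"
    using p by (intro determinedI[OF T]) (cases i; cases j; auto)
  moreover have "determined S {} {#}"
    by (simp add: determined_def)
  moreover have "extends_to S ?I ?T [] {} {#} [(fst p, fst t), (fst q, fst r)]"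
  proof (rule extends_toI[OF T tangle_empty])
    fix f assume Q: "\<forall>e\<in>S \<union> ?I. f e \<in> Q" and f: "\<forall>n\<in>#?T. dart_rule f n"
    then have "f (fst p) = f (fst t) \<and> f (fst q) = f (fst r)"
      using cross_clasp[of "toward f q" "toward f (e, i)" "toward f (h, j)" "toward f p"
        "toward f r" "toward f t"] p glue[of f]
      by (auto simp: toward_Not toward_closed)
    then show "\<exists>g. (\<forall>s\<in>S. g s = f s) \<and> (\<forall>e\<in>{}. g e \<in> Q) \<and> (\<forall>n\<in>#{#}. dart_rule g n) \<and>
      (\<forall>(x, y)\<in>set [(fst p, fst t), (fst q, fst r)]. g x = g y)"
      by auto
  qed
  moreover have "extends_to S {} {#} [(fst p, fst t), (fst q, fst r)] ?I ?T []"
  proof (rule extends_toI[OF tangle_empty T])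
    fix f assume Q: "\<forall>e\<in>S \<union> {}. f e \<in> Q"
      and f: "\<forall>(x, y)\<in>set [(fst p, fst t), (fst q, fst r)]. f x = f y"
    have eq: "toward f p = opp (toward f t)" "toward f q = opp (toward f r)"
      and Q': "toward f p \<in> Q" "toward f q \<in> Q" "toward f r \<in> Q" "toward f t \<in> Q"
      using Q f p glue by (auto simp: toward_closed)
    \<comment> \<open>the crossing solved from its outer semiarcs \<open>p\<close> and \<open>q\<close>\<close>
    define u where "u = opp (toward f p \<rightharpoonup> opp (toward f q))"
    define v where "v = opp (toward f q) \<rightharpoondown> toward f p"
    have uv: "u \<in> Q" "v \<in> Q"
      using Q' by (auto simp: u_def v_def closed)
    have c: "cross (toward f q) u v (toward f p)"
      using uv Q' by (simp add: cross_from_da) (simp add: u_def v_def)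
    then have c': "cross (toward f r) (toward f t) (opp v) (opp u)"
      using cross_clasp uv Q' eq by blast
    show "\<exists>g. (\<forall>s\<in>S. g s = f s) \<and> (\<forall>e\<in>?I. g e \<in> Q) \<and> (\<forall>n\<in>#?T. dart_rule g n) \<and>
      (\<forall>(x, y)\<in>set []. g x = g y)"
      using disj uv c c' d
      by (intro exI[of _ "f(e := place i u, h := place j v)"])
        (auto simp: toward_other ne toward_place toward_place_Not place_closed)
  qed
  ultimately show ?thesis
    unfolding interchangeable_def by blast
qed

lemma interchangeable_R3_a:
  assumes T: "tangle S {a, b, c} {#Crossing p1 (a, i) (b, j) p0, Crossing p2 p3 (c, k) (a, \<not> i),
      Crossing (c, \<not> k) p4 p5 (b, \<not> j)#}"
      (is "tangle S ?I ?T")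
    and T': "tangle S {a', b', c'} {#Crossing (c', k') (a', i') p5 p0,
      Crossing (b', j') p3 p4 (a', \<not> i'), Crossing p2 (b', \<not> j') (c', \<not> k') p1#}"
      (is "tangle S ?I' ?T'")
  shows "interchangeable S ?I ?T ?I' ?T' []"
proof -
  let ?B = "{#p0, p1, p2, p3, p4, p5#}"
  have B: "(\<Sum>n\<in>#?T. node_darts n) = both_darts [a, b, c] + ?B"
    by (cases i; cases j; cases k; simp)
  have p: "\<forall>d\<in>#?B. fst d \<in> S" and d: "distinct [a, b, c]"
    by (rule tangle_boundary[OF T _ B], simp)+
  have B': "(\<Sum>n\<in>#?T'. node_darts n) = both_darts [a', b', c'] + ?B"
    by (cases i'; cases j'; cases k'; simp)
  have d': "distinct [a', b', c']"
    by (rule tangle_boundary[OF T' _ B'], simp)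
  have disj: "S \<inter> ?I = {}" "S \<inter> ?I' = {}"
    using T T' tangle_disjoint by blast+
  have ne: "fst d \<noteq> e" if "d \<in># ?B" "e \<in> ?I \<union> ?I'" for d e
    using p disj that by blast
  have "determined S ?I ?T"
    using p by (intro determinedI[OF T]) (cases i; cases j; cases k; auto)
  moreover have "determined S ?I' ?T'"
    using p by (intro determinedI[OF T']) (cases i'; cases j'; cases k'; auto)
  moreover have "extends_to S ?I ?T [] ?I' ?T' []"
  proof (rule extends_toI[OF T T'])
    fix f assume Q: "\<forall>e\<in>S \<union> ?I. f e \<in> Q" and f: "\<forall>n\<in>#?T. dart_rule f n"
    obtain u v w where uvw: "u \<in> Q" "v \<in> Q" "w \<in> Q"
      "cross w u (toward f p5) (toward f p0)" "cross v (toward f p3) (toward f p4) (opp u)"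
      "cross (toward f p2) (opp v) (opp w) (toward f p1)"
      using cross_R3_a[of "toward f (a, i)" "toward f (b, j)" "toward f (c, k)" "toward f p0" "toward f p1" "toward f p2" "toward f p3" "toward f p4" "toward f p5"] Q f p
      by (auto simp: toward_Not toward_closed)
    show "\<exists>g. (\<forall>s\<in>S. g s = f s) \<and> (\<forall>e\<in>?I'. g e \<in> Q) \<and> (\<forall>n\<in>#?T'. dart_rule g n) \<and>
      (\<forall>(x, y)\<in>set []. g x = g y)"
      using disj uvw d'
      by (intro exI[of _ "f(a' := place i' u, b' := place j' v, c' := place k' w)"])
        (auto simp: toward_other ne toward_place toward_place_Not place_closed)
  qed
  moreover have "extends_to S ?I' ?T' [] ?I ?T []"
  proof (rule extends_toI[OF T' T])
    fix f assume Q: "\<forall>e\<in>S \<union> ?I'. f e \<in> Q" and f: "\<forall>n\<in>#?T'. dart_rule f n"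
    obtain u v w where uvw: "u \<in> Q" "v \<in> Q" "w \<in> Q"
      "cross (toward f p1) u v (toward f p0)" "cross (toward f p2) (toward f p3) w (opp u)"
      "cross (opp w) (toward f p4) (toward f p5) (opp v)"
      using cross_R3_a_inverse[of "toward f (a', i')" "toward f (b', j')" "toward f (c', k')" "toward f p0" "toward f p1" "toward f p2" "toward f p3" "toward f p4" "toward f p5"] Q f p
      by (auto simp: toward_Not toward_closed)
    show "\<exists>g. (\<forall>s\<in>S. g s = f s) \<and> (\<forall>e\<in>?I. g e \<in> Q) \<and> (\<forall>n\<in>#?T. dart_rule g n) \<and>
      (\<forall>(x, y)\<in>set []. g x = g y)"
      using disj uvw d
      by (intro exI[of _ "f(a := place i u, b := place j v, c := place k w)"])
        (auto simp: toward_other ne toward_place toward_place_Not place_closed)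
  qed
  ultimately show ?thesis
    unfolding interchangeable_def by blast
qed

lemma interchangeable_R3_b:
  assumes T: "tangle S {a, b, c} {#Crossing p1 (a, i) (b, j) p0, Crossing p2 p3 (c, k) (a, \<not> i),
      Crossing (b, \<not> j) (c, \<not> k) p4 p5#}"
      (is "tangle S ?I ?T")
    and T': "tangle S {a', b', c'} {#Crossing (c', k') (a', i') p5 p0,
      Crossing (b', j') p3 p4 (a', \<not> i'), Crossing p1 p2 (b', \<not> j') (c', \<not> k')#}"
      (is "tangle S ?I' ?T'")
  shows "interchangeable S ?I ?T ?I' ?T' []"
proof -
  let ?B = "{#p0, p1, p2, p3, p4, p5#}"
  have B: "(\<Sum>n\<in>#?T. node_darts n) = both_darts [a, b, c] + ?B"
    by (cases i; cases j; cases k; simp)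
  have p: "\<forall>d\<in>#?B. fst d \<in> S" and d: "distinct [a, b, c]"
    by (rule tangle_boundary[OF T _ B], simp)+
  have B': "(\<Sum>n\<in>#?T'. node_darts n) = both_darts [a', b', c'] + ?B"
    by (cases i'; cases j'; cases k'; simp)
  have d': "distinct [a', b', c']"
    by (rule tangle_boundary[OF T' _ B'], simp)
  have disj: "S \<inter> ?I = {}" "S \<inter> ?I' = {}"
    using T T' tangle_disjoint by blast+
  have ne: "fst d \<noteq> e" if "d \<in># ?B" "e \<in> ?I \<union> ?I'" for d e
    using p disj that by blast
  have "determined S ?I ?T"
    using p by (intro determinedI[OF T]) (cases i; cases j; cases k; auto)
  moreover have "determined S ?I' ?T'"
    using p by (intro determinedI[OF T']) (cases i'; cases j'; cases k'; auto)
  moreover have "extends_to S ?I ?T [] ?I' ?T' []"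
  proof (rule extends_toI[OF T T'])
    fix f assume Q: "\<forall>e\<in>S \<union> ?I. f e \<in> Q" and f: "\<forall>n\<in>#?T. dart_rule f n"
    obtain u v w where uvw: "u \<in> Q" "v \<in> Q" "w \<in> Q"
      "cross w u (toward f p5) (toward f p0)" "cross v (toward f p3) (toward f p4) (opp u)"
      "cross (toward f p1) (toward f p2) (opp v) (opp w)"
      using cross_R3_b[of "toward f (a, i)" "toward f (b, j)" "toward f (c, k)" "toward f p0" "toward f p1" "toward f p2" "toward f p3" "toward f p4" "toward f p5"] Q f p
      by (auto simp: toward_Not toward_closed)
    show "\<exists>g. (\<forall>s\<in>S. g s = f s) \<and> (\<forall>e\<in>?I'. g e \<in> Q) \<and> (\<forall>n\<in>#?T'. dart_rule g n) \<and>
      (\<forall>(x, y)\<in>set []. g x = g y)"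
      using disj uvw d'
      by (intro exI[of _ "f(a' := place i' u, b' := place j' v, c' := place k' w)"])
        (auto simp: toward_other ne toward_place toward_place_Not place_closed)
  qed
  moreover have "extends_to S ?I' ?T' [] ?I ?T []"
  proof (rule extends_toI[OF T' T])
    fix f assume Q: "\<forall>e\<in>S \<union> ?I'. f e \<in> Q" and f: "\<forall>n\<in>#?T'. dart_rule f n"
    obtain u v w where uvw: "u \<in> Q" "v \<in> Q" "w \<in> Q"
      "cross (toward f p1) u v (toward f p0)" "cross (toward f p2) (toward f p3) w (opp u)"
      "cross (opp v) (opp w) (toward f p4) (toward f p5)"
      using cross_R3_b_inverse[of "toward f (a', i')" "toward f (b', j')" "toward f (c', k')" "toward f p0" "toward f p1" "toward f p2" "toward f p3" "toward f p4" "toward f p5"] Q f p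
      by (auto simp: toward_Not toward_closed)
    show "\<exists>g. (\<forall>s\<in>S. g s = f s) \<and> (\<forall>e\<in>?I. g e \<in> Q) \<and> (\<forall>n\<in>#?T. dart_rule g n) \<and>
      (\<forall>(x, y)\<in>set []. g x = g y)"
      using disj uvw d
      by (intro exI[of _ "f(a := place i u, b := place j v, c := place k w)"])
        (auto simp: toward_other ne toward_place toward_place_Not place_closed)
  qed
  ultimately show ?thesis
    unfolding interchangeable_def by blast
qed

lemma interchangeable_strand_over_vertex:
  assumes T: "tangle S {e} {#Vertex x y (e, i), Crossing (e, \<not> i) t z s#}"
      (is "tangle S ?I ?T")
    and T': "tangle S {a, b, m} {#Vertex (a, j) (b, k) z, Crossing x (m, l) (a, \<not> j) s,
      Crossing y t (b, \<not> k) (m, \<not> l)#}"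
      (is "tangle S ?I' ?T'")
  shows "interchangeable S ?I ?T ?I' ?T' []"
proof -
  let ?B = "{#x, y, t, z, s#}"
  have B: "(\<Sum>n\<in>#?T. node_darts n) = both_darts [e] + ?B"
    by (cases i; simp)
  have p: "\<forall>d\<in>#?B. fst d \<in> S"
    by (rule tangle_boundary[OF T _ B], simp)+
  have B': "(\<Sum>n\<in>#?T'. node_darts n) = both_darts [a, b, m] + ?B"
    by (cases j; cases k; cases l; simp)
  have d': "distinct [a, b, m]"
    by (rule tangle_boundary[OF T' _ B'], simp)
  have disj: "S \<inter> ?I = {}" "S \<inter> ?I' = {}"
    using T T' tangle_disjoint by blast+
  have ne: "fst d \<noteq> e" if "d \<in># ?B" "e \<in> ?I \<union> ?I'" for d e
    using p disj that by blast
  have "determined S ?I ?T"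
    using p by (intro determinedI[OF T]) (cases i; auto)
  moreover have "determined S ?I' ?T'"
    using p by (intro determinedI[OF T']) (cases j; cases k; cases l; auto)
  moreover have "extends_to S ?I ?T [] ?I' ?T' []"
  proof (rule extends_toI[OF T T'])
    fix f assume Q: "\<forall>e\<in>S \<union> ?I. f e \<in> Q" and f: "\<forall>n\<in>#?T. dart_rule f n"
    obtain u v w where uvw: "u \<in> Q" "v \<in> Q" "w \<in> Q"
      "vert u v (toward f z)" "cross (toward f x) w (opp u) (toward f s)" "cross (toward f y) (toward f t) (opp v) (opp w)"
      using strand_over_vert[of "toward f x" "toward f y" "toward f (e, i)" "toward f t" "toward f z" "toward f s"] Q f p
      by (auto simp: toward_Not toward_closed)
    show "\<exists>g. (\<forall>s\<in>S. g s = f s) \<and> (\<forall>e\<in>?I'. g e \<in> Q) \<and> (\<forall>n\<in>#?T'. dart_rule g n) \<and>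
      (\<forall>(x, y)\<in>set []. g x = g y)"
      using disj uvw d'
      by (intro exI[of _ "f(a := place j u, b := place k v, m := place l w)"])
        (auto simp: toward_other ne toward_place toward_place_Not place_closed)
  qed
  moreover have "extends_to S ?I' ?T' [] ?I ?T []"
  proof (rule extends_toI[OF T' T])
    fix f assume Q: "\<forall>e\<in>S \<union> ?I'. f e \<in> Q" and f: "\<forall>n\<in>#?T'. dart_rule f n"
    obtain u where u: "u \<in> Q"
      "vert (toward f x) (toward f y) u" "cross (opp u) (toward f t) (toward f z) (toward f s)"
      using strand_over_vert_inverse[of "toward f x" "toward f y" "toward f t" "toward f z" "toward f s" "toward f (a, j)" "toward f (b, k)" "toward f (m, l)"] Q f p
      by (auto simp: toward_Not toward_closed)
    show "\<exists>g. (\<forall>s\<in>S. g s = f s) \<and> (\<forall>e\<in>?I. g e \<in> Q) \<and> (\<forall>n\<in>#?T. dart_rule g n) \<and>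
      (\<forall>(x, y)\<in>set []. g x = g y)"
      using disj u
      by (intro exI[of _ "f(e := place i u)"])
        (auto simp: toward_other ne toward_place toward_place_Not place_closed)
  qed
  ultimately show ?thesis
    unfolding interchangeable_def by blast
qed

lemma interchangeable_strand_under_vertex:
  assumes T: "tangle S {e} {#Vertex x y (e, i), Crossing s (e, \<not> i) t z#}"
      (is "tangle S ?I ?T")
    and T': "tangle S {a, b, m} {#Vertex (a, j) (b, k) z, Crossing s x (m, l) (a, \<not> j),
      Crossing (m, \<not> l) y t (b, \<not> k)#}"
      (is "tangle S ?I' ?T'")
  shows "interchangeable S ?I ?T ?I' ?T' []"
proof -
  let ?B = "{#x, y, t, z, s#}"
  have B: "(\<Sum>n\<in>#?T. node_darts n) = both_darts [e] + ?B"
    by (cases i; simp)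
  have p: "\<forall>d\<in>#?B. fst d \<in> S"
    by (rule tangle_boundary[OF T _ B], simp)+
  have B': "(\<Sum>n\<in>#?T'. node_darts n) = both_darts [a, b, m] + ?B"
    by (cases j; cases k; cases l; simp)
  have d': "distinct [a, b, m]"
    by (rule tangle_boundary[OF T' _ B'], simp)
  have disj: "S \<inter> ?I = {}" "S \<inter> ?I' = {}"
    using T T' tangle_disjoint by blast+
  have ne: "fst d \<noteq> e" if "d \<in># ?B" "e \<in> ?I \<union> ?I'" for d e
    using p disj that by blast
  have "determined S ?I ?T"
    using p by (intro determinedI[OF T]) (cases i; auto)
  moreover have "determined S ?I' ?T'"
    using p by (intro determinedI[OF T']) (cases j; cases k; cases l; auto)
  moreover have "extends_to S ?I ?T [] ?I' ?T' []"
  proof (rule extends_toI[OF T T'])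
    fix f assume Q: "\<forall>e\<in>S \<union> ?I. f e \<in> Q" and f: "\<forall>n\<in>#?T. dart_rule f n"
    obtain u v w where uvw: "u \<in> Q" "v \<in> Q" "w \<in> Q"
      "vert u v (toward f z)" "cross (toward f s) (toward f x) w (opp u)" "cross (opp w) (toward f y) (toward f t) (opp v)"
      using strand_under_vert[of "toward f x" "toward f y" "toward f (e, i)" "toward f t" "toward f z" "toward f s"] Q f p
      by (auto simp: toward_Not toward_closed)
    show "\<exists>g. (\<forall>s\<in>S. g s = f s) \<and> (\<forall>e\<in>?I'. g e \<in> Q) \<and> (\<forall>n\<in>#?T'. dart_rule g n) \<and>
      (\<forall>(x, y)\<in>set []. g x = g y)"
      using disj uvw d'
      by (intro exI[of _ "f(a := place j u, b := place k v, m := place l w)"])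
        (auto simp: toward_other ne toward_place toward_place_Not place_closed)
  qed
  moreover have "extends_to S ?I' ?T' [] ?I ?T []"
  proof (rule extends_toI[OF T' T])
    fix f assume Q: "\<forall>e\<in>S \<union> ?I'. f e \<in> Q" and f: "\<forall>n\<in>#?T'. dart_rule f n"
    obtain u where u: "u \<in> Q"
      "vert (toward f x) (toward f y) u" "cross (toward f s) (opp u) (toward f t) (toward f z)"
      using strand_under_vert_inverse[of "toward f x" "toward f y" "toward f t" "toward f z" "toward f s" "toward f (a, j)" "toward f (b, k)" "toward f (m, l)"] Q f p
      by (auto simp: toward_Not toward_closed)
    show "\<exists>g. (\<forall>s\<in>S. g s = f s) \<and> (\<forall>e\<in>?I. g e \<in> Q) \<and> (\<forall>n\<in>#?T. dart_rule g n) \<and>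
      (\<forall>(x, y)\<in>set []. g x = g y)"
      using disj u
      by (intro exI[of _ "f(e := place i u)"])
        (auto simp: toward_other ne toward_place toward_place_Not place_closed)
  qed
  ultimately show ?thesis
    unfolding interchangeable_def by blast
qed

lemma interchangeable_twist_a:
  assumes T: "tangle S {a, b} {#Vertex (a, i) (b, j) z, Crossing (a, \<not> i) p q (b, \<not> j)#}"
      (is "tangle S ?I ?T")
    and T': "tangle S {} {#Vertex p q z#}"
      (is "tangle S ?I' ?T'")
  shows "interchangeable S ?I ?T ?I' ?T' []"
proof -
  let ?B = "{#p, q, z#}"
  have B: "(\<Sum>n\<in>#?T. node_darts n) = both_darts [a, b] + ?B"
    by (cases i; cases j; simp)
  have p: "\<forall>d\<in>#?B. fst d \<in> S" and d: "distinct [a, b]"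
    by (rule tangle_boundary[OF T _ B], simp)+
  have disj: "S \<inter> ?I = {}" "S \<inter> ?I' = {}"
    using T T' tangle_disjoint by blast+
  have ne: "fst d \<noteq> e" if "d \<in># ?B" "e \<in> ?I \<union> ?I'" for d e
    using p disj that by blast
  have "determined S ?I ?T"
    using p by (intro determinedI[OF T]) (cases i; cases j; auto)
  moreover have "determined S ?I' ?T'"
    by (simp add: determined_def)
  moreover have "extends_to S ?I ?T [] ?I' ?T' []"
  proof (rule extends_toI[OF T T'])
    fix f assume Q: "\<forall>e\<in>S \<union> ?I. f e \<in> Q" and f: "\<forall>n\<in>#?T. dart_rule f n"
    show "\<exists>g. (\<forall>s\<in>S. g s = f s) \<and> (\<forall>e\<in>?I'. g e \<in> Q) \<and> (\<forall>n\<in>#?T'. dart_rule g n) \<and>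
      (\<forall>(x, y)\<in>set []. g x = g y)"
      using untwist_a[of "toward f (a, i)" "toward f (b, j)" "toward f p" "toward f q" "toward f z"] Q f p
      by (intro exI[of _ f]) (auto simp: toward_Not toward_closed)
  qed
  moreover have "extends_to S ?I' ?T' [] ?I ?T []"
  proof (rule extends_toI[OF T' T])
    fix f assume Q: "\<forall>e\<in>S \<union> ?I'. f e \<in> Q" and f: "\<forall>n\<in>#?T'. dart_rule f n"
    obtain u v where uv: "u \<in> Q" "v \<in> Q"
      "vert u v (toward f z)" "cross (opp u) (toward f p) (toward f q) (opp v)"
      using twist_a[of "toward f p" "toward f q" "toward f z"] Q f p
      by (auto simp: toward_Not toward_closed)
    show "\<exists>g. (\<forall>s\<in>S. g s = f s) \<and> (\<forall>e\<in>?I. g e \<in> Q) \<and> (\<forall>n\<in>#?T. dart_rule g n) \<and>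
      (\<forall>(x, y)\<in>set []. g x = g y)"
      using disj uv d
      by (intro exI[of _ "f(a := place i u, b := place j v)"])
        (auto simp: toward_other ne toward_place toward_place_Not place_closed)
  qed
  ultimately show ?thesis
    unfolding interchangeable_def by blast
qed

lemma interchangeable_twist_b:
  assumes T: "tangle S {a, b} {#Vertex (a, i) (b, j) z, Crossing (b, \<not> j) (a, \<not> i) p q#}"
      (is "tangle S ?I ?T")
    and T': "tangle S {} {#Vertex p q z#}"
      (is "tangle S ?I' ?T'")
  shows "interchangeable S ?I ?T ?I' ?T' []"
proof -
  let ?B = "{#p, q, z#}"
  have B: "(\<Sum>n\<in>#?T. node_darts n) = both_darts [a, b] + ?B"
    by (cases i; cases j; simp)
  have p: "\<forall>d\<in>#?B. fst d \<in> S" and d: "distinct [a, b]"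
    by (rule tangle_boundary[OF T _ B], simp)+
  have disj: "S \<inter> ?I = {}" "S \<inter> ?I' = {}"
    using T T' tangle_disjoint by blast+
  have ne: "fst d \<noteq> e" if "d \<in># ?B" "e \<in> ?I \<union> ?I'" for d e
    using p disj that by blast
  have "determined S ?I ?T"
    using p by (intro determinedI[OF T]) (cases i; cases j; auto)
  moreover have "determined S ?I' ?T'"
    by (simp add: determined_def)
  moreover have "extends_to S ?I ?T [] ?I' ?T' []"
  proof (rule extends_toI[OF T T'])
    fix f assume Q: "\<forall>e\<in>S \<union> ?I. f e \<in> Q" and f: "\<forall>n\<in>#?T. dart_rule f n"
    show "\<exists>g. (\<forall>s\<in>S. g s = f s) \<and> (\<forall>e\<in>?I'. g e \<in> Q) \<and> (\<forall>n\<in>#?T'. dart_rule g n) \<and>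
      (\<forall>(x, y)\<in>set []. g x = g y)"
      using untwist_b[of "toward f (a, i)" "toward f (b, j)" "toward f p" "toward f q" "toward f z"] Q f p
      by (intro exI[of _ f]) (auto simp: toward_Not toward_closed)
  qed
  moreover have "extends_to S ?I' ?T' [] ?I ?T []"
  proof (rule extends_toI[OF T' T])
    fix f assume Q: "\<forall>e\<in>S \<union> ?I'. f e \<in> Q" and f: "\<forall>n\<in>#?T'. dart_rule f n"
    obtain u v where uv: "u \<in> Q" "v \<in> Q"
      "vert u v (toward f z)" "cross (opp v) (opp u) (toward f p) (toward f q)"
      using twist_b[of "toward f p" "toward f q" "toward f z"] Q f p
      by (auto simp: toward_Not toward_closed)
    show "\<exists>g. (\<forall>s\<in>S. g s = f s) \<and> (\<forall>e\<in>?I. g e \<in> Q) \<and> (\<forall>n\<in>#?T. dart_rule g n) \<and>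
      (\<forall>(x, y)\<in>set []. g x = g y)"
      using disj uv d
      by (intro exI[of _ "f(a := place i u, b := place j v)"])
        (auto simp: toward_other ne toward_place toward_place_Not place_closed)
  qed
  ultimately show ?thesis
    unfolding interchangeable_def by blast
qed

lemma interchangeable_IH:
  assumes T: "tangle S {e} {#Vertex a b (e, i), Vertex c d (e, \<not> i)#}"
      (is "tangle S ?I ?T")
    and T': "tangle S {h} {#Vertex b c (h, j), Vertex d a (h, \<not> j)#}"
      (is "tangle S ?I' ?T'")
  shows "interchangeable S ?I ?T ?I' ?T' []"
proof -
  let ?B = "{#a, b, c, d#}"
  have B: "(\<Sum>n\<in>#?T. node_darts n) = both_darts [e] + ?B"
    by (cases i; simp)
  have p: "\<forall>d\<in>#?B. fst d \<in> S"
    by (rule tangle_boundary[OF T _ B], simp)+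
  have disj: "S \<inter> ?I = {}" "S \<inter> ?I' = {}"
    using T T' tangle_disjoint by blast+
  have ne: "fst d \<noteq> e" if "d \<in># ?B" "e \<in> ?I \<union> ?I'" for d e
    using p disj that by blast
  have "determined S ?I ?T"
    using p by (intro determinedI[OF T]) (cases i; auto)
  moreover have "determined S ?I' ?T'"
    using p by (intro determinedI[OF T']) (cases j; auto)
  moreover have "extends_to S ?I ?T [] ?I' ?T' []"
  proof (rule extends_toI[OF T T'])
    fix f assume Q: "\<forall>e\<in>S \<union> ?I. f e \<in> Q" and f: "\<forall>n\<in>#?T. dart_rule f n"
    obtain u where u: "u \<in> Q"
      "vert (toward f b) (toward f c) u" "vert (toward f d) (toward f a) (opp u)"
      using vert_IH[of "toward f a" "toward f b" "toward f c" "toward f d" "toward f (e, i)"] Q f p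
      by (auto simp: toward_Not toward_closed)
    show "\<exists>g. (\<forall>s\<in>S. g s = f s) \<and> (\<forall>e\<in>?I'. g e \<in> Q) \<and> (\<forall>n\<in>#?T'. dart_rule g n) \<and>
      (\<forall>(x, y)\<in>set []. g x = g y)"
      using disj u
      by (intro exI[of _ "f(h := place j u)"])
        (auto simp: toward_other ne toward_place toward_place_Not place_closed)
  qed
  moreover have "extends_to S ?I' ?T' [] ?I ?T []"
  proof (rule extends_toI[OF T' T])
    fix f assume Q: "\<forall>e\<in>S \<union> ?I'. f e \<in> Q" and f: "\<forall>n\<in>#?T'. dart_rule f n"
    obtain u where u: "u \<in> Q"
      "vert (toward f a) (toward f b) u" "vert (toward f c) (toward f d) (opp u)"
      using vert_IH_inverse[of "toward f a" "toward f b" "toward f c" "toward f d" "toward f (h, j)"] Q f p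
      by (auto simp: toward_Not toward_closed)
    show "\<exists>g. (\<forall>s\<in>S. g s = f s) \<and> (\<forall>e\<in>?I. g e \<in> Q) \<and> (\<forall>n\<in>#?T. dart_rule g n) \<and>
      (\<forall>(x, y)\<in>set []. g x = g y)"
      using disj u
      by (intro exI[of _ "f(e := place i u)"])
        (auto simp: toward_other ne toward_place toward_place_Not place_closed)
  qed
  ultimately show ?thesis
    unfolding interchangeable_def by blast
qed

lemma handlebody_move_interchangeable:
  assumes "handlebody_move I T I' T' w" "tangle S I T" "tangle S I' T'"
  shows "interchangeable S I T I' T' w"
  using assms
proof cases
  case R1_a then show ?thesis using assms interchangeable_R1_a by metis
next
  case R1_b then show ?thesis using assms interchangeable_R1_b by metis
next
  case R2 then show ?thesis using assms interchangeable_R2 by metis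
next
  case R3_a then show ?thesis using assms interchangeable_R3_a by metis
next
  case R3_b then show ?thesis using assms interchangeable_R3_b by metis
next
  case strand_over_vertex then show ?thesis using assms interchangeable_strand_over_vertex by metis
next
  case strand_under_vertex then show ?thesis using assms interchangeable_strand_under_vertex by metis
next
  case twist_a then show ?thesis using assms interchangeable_twist_a by metis
next
  case twist_b then show ?thesis using assms interchangeable_twist_b by metis
next
  case IH then show ?thesis using assms interchangeable_IH by metis
qed

end

section \<open>Joining semiarcs\<close>

text \<open>
  The total renaming effected by a list of joins, so that joining is a single relabeling.
\<close>

fun join_map :: "(nat \<times> nat) list \<Rightarrow> nat \<Rightarrow> nat" where
  "join_map [] = id"
| "join_map ((x, y) # w) = join_map (map (map_prod (id(y := x)) (id(y := x))) w) \<circ> id(y := x)"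

lemma join_induct [case_names Nil Cons]:
  assumes "P []"
    and "\<And>x y w. P (map (map_prod (id(y := x)) (id(y := x))) w) \<Longrightarrow> P ((x, y) # w)"
  shows "P w"
proof (induction w rule: length_induct)
  case (1 w)
  then show ?case
    using assms by (cases w) auto
qed

lemma relabel_id: "relabel id D = D"
  by (cases D) (simp add: relabel_def apfst_def node.map_id0 map_prod.id)

lemma relabel_comp: "relabel s (relabel r D) = relabel (s \<circ> r) D"
  by (simp add: relabel_def image_comp multiset.map_comp node.map_comp o_def apfst_compose)

lemma join_eq_relabel: "join w D = relabel (join_map w) D"
  by (induction w arbitrary: D rule: join_induct) (simp_all add: relabel_id relabel_comp Let_def)

lemma join_map_identifies: "(x, y) \<in> set w \<Longrightarrow> join_map w x = join_map w y"
proof (induction w arbitrary: x y rule: join_induct)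
  case (Cons a b w)
  let ?r = "id(b := a)"
  show ?case
  proof (cases "(x, y) = (a, b)")
    case False
    then have "(?r x, ?r y) \<in> set (map (map_prod ?r ?r) w)"
      using Cons.prems by (force simp: map_prod_def)
    then show ?thesis
      using Cons.IH by (simp del: fun_upd_apply)
  qed simp
qed simp

text \<open>
  A coloring that takes equal values on the semiarcs to be joined is constant on the classes of
  the joined diagram, since each class is generated by the listed pairs.
\<close>

lemma join_map_respected:
  assumes "\<forall>(x, y)\<in>set w. f x = f y"
  shows "f (join_map w e) = f e"
  using assms
proof (induction w arbitrary: e rule: join_induct)
  case (Cons a b w)
  let ?r = "id(b := a)"
  have r: "f (?r u) = f u" for u
    using Cons.prems by simp
  have "\<forall>(x, y)\<in>set (map (map_prod ?r ?r) w). f x = f y"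
    using Cons.prems r by (auto simp: map_prod_def simp del: fun_upd_apply)
  then have "f (join_map (map (map_prod ?r ?r) w) (?r e)) = f (?r e)"
    by (rule Cons.IH)
  then show ?case
    using r by simp
qed simp

section \<open>Colorings and their boundary values\<close>

lemma obeys_rule_relabel:
  "obeys_rule un ov mul f (map_node (apfst r) n) \<longleftrightarrow> obeys_rule un ov mul (f \<circ> r) n"
  by (cases n) (auto simp: right_under_def left_under_def right_over_def left_over_def Let_def
    right_left_third_def right_left_third_at_def)

lemma obeys_rule_cong:
  assumes "\<And>d. d \<in># node_darts n \<Longrightarrow> f (fst d) = g (fst d)"
  shows "obeys_rule un ov mul f n \<longleftrightarrow> obeys_rule un ov mul g n"
  using assms
  by (cases n) (auto simp: right_under_def left_under_def right_over_def left_over_def Let_def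
    right_left_third_def right_left_third_at_def)

lemma colorings_relabel:
  "f \<in> colorings Q un ov mul (relabel r D) \<longleftrightarrow>
     f \<in> extensional (r ` semiarcs D) \<and> (\<forall>e\<in>semiarcs D. f (r e) \<in> Q) \<and>
     (\<forall>n\<in>#nodes D. obeys_rule un ov mul (f \<circ> r) n)"
  by (auto simp: colorings_def relabel_def PiE_def Pi_def obeys_rule_relabel)

text \<open>
  \<open>r\<close> tells which semiarc of the diagram each \<open>s \<in> S\<close> has become.
\<close>

definition along :: "nat set \<Rightarrow> (nat \<Rightarrow> nat) \<Rightarrow> (nat \<Rightarrow> 'q) \<Rightarrow> nat \<Rightarrow> 'q" where
  "along S r f = restrict (f \<circ> r) S"

lemma along_eq_iff: "along S r f = along S r' g \<longleftrightarrow> (\<forall>s\<in>S. f (r s) = g (r' s))"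
  by (auto simp: along_def restrict_def fun_eq_iff)

definition same_boundary :: "nat set \<Rightarrow> (nat \<Rightarrow> nat) \<Rightarrow> (nat \<Rightarrow> nat) \<Rightarrow>
    (nat \<Rightarrow> 'q) set \<Rightarrow> (nat \<Rightarrow> 'q) set \<Rightarrow> bool" where
  "same_boundary S r r' C C' \<longleftrightarrow>
     inj_on (along S r) C \<and> inj_on (along S r') C' \<and> along S r ` C = along S r' ` C'"

context reversible_biquandle
begin

lemma fills_cong:
  assumes "tangle S I T" "\<forall>e\<in>S \<union> I. f e = g e"
  shows "fills S I T f \<longleftrightarrow> fills S I T g"
proof -
  have "obeys_rule un ov mul f n \<longleftrightarrow> obeys_rule un ov mul g n" if "n \<in># T" for n
    using assms that by (intro obeys_rule_cong) (auto simp: tangle_def)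
  then show ?thesis
    using assms(2) by (auto simp: fills_def)
qed

lemma colorings_join:
  "f \<in> colorings Q un ov mul (join w (Diagram (S \<union> I) (M + T))) \<longleftrightarrow>
     f \<in> extensional (join_map w ` (S \<union> I)) \<and> fills S I T (f \<circ> join_map w) \<and>
     (\<forall>n\<in>#M. obeys_rule un ov mul (f \<circ> join_map w) n)"
  by (auto simp: join_eq_relabel colorings_relabel fills_def)

lemma inj_on_along_join:
  assumes "determined S I T"
  shows "inj_on (along S (join_map w)) (colorings Q un ov mul (join w (Diagram (S \<union> I) (M + T))))"
proof (rule inj_onI, unfold colorings_join along_eq_iff)
  fix f g
  assume f: "f \<in> extensional (join_map w ` (S \<union> I)) \<and> fills S I T (f \<circ> join_map w) \<and>
      (\<forall>n\<in>#M. obeys_rule un ov mul (f \<circ> join_map w) n)"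
    and g: "g \<in> extensional (join_map w ` (S \<union> I)) \<and> fills S I T (g \<circ> join_map w) \<and>
      (\<forall>n\<in>#M. obeys_rule un ov mul (g \<circ> join_map w) n)"
    and S: "\<forall>s\<in>S. f (join_map w s) = g (join_map w s)"
  have "\<forall>e\<in>I. (f \<circ> join_map w) e = (g \<circ> join_map w) e"
    using assms[unfolded determined_def, rule_format, of "f \<circ> join_map w" "g \<circ> join_map w"]
      f g S by simp
  then show "f = g"
    using S f g by (intro extensionalityI[of f "join_map w ` (S \<union> I)" g]) auto
qed

text \<open>
  Two sides of a move are compared through the outer part \<open>M\<close>, on which the coloring is left alone.
  Both diagrams are written as joins, with an empty list for the one in which nothing is joined.
\<close>

lemma along_join_subset:
  assumes ext: "extends_to S I T w I' T' w'" and T': "tangle S I' T'"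
    and M: "\<And>n d. n \<in># M \<Longrightarrow> d \<in># node_darts n \<Longrightarrow> fst d \<in> S"
  shows "along S (join_map w) ` colorings Q un ov mul (join w (Diagram (S \<union> I) (M + T))) \<subseteq>
    along S (join_map w') ` colorings Q un ov mul (join w' (Diagram (S \<union> I') (M + T')))"
proof
  fix b
  assume "b \<in> along S (join_map w) ` colorings Q un ov mul (join w (Diagram (S \<union> I) (M + T)))"
  then obtain f0 where f0: "f0 \<in> colorings Q un ov mul (join w (Diagram (S \<union> I) (M + T)))"
    and b: "b = along S (join_map w) f0"
    by blast
  define f where "f = f0 \<circ> join_map w"
  have "fills S I T f" and fM: "\<forall>n\<in>#M. obeys_rule un ov mul f n"
    using f0 unfolding colorings_join f_def by blast+
  moreover have "\<forall>(x, y)\<in>set w. f x = f y"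
    unfolding f_def using join_map_identifies by fastforce
  ultimately obtain g where g: "\<forall>s\<in>S. g s = f s" "fills S I' T' g" "\<forall>(x, y)\<in>set w'. g x = g y"
    using ext unfolding extends_to_def by blast
  define g0 where "g0 = restrict g (join_map w' ` (S \<union> I'))"
  have g0: "(g0 \<circ> join_map w') e = g e" if "e \<in> S \<union> I'" for e
    using that join_map_respected[OF g(3)] by (auto simp: g0_def)
  have "fills S I' T' (g0 \<circ> join_map w')"
    using fills_cong[OF T', of "g0 \<circ> join_map w'" g] g0 g(2) by blast
  moreover have "obeys_rule un ov mul (g0 \<circ> join_map w') n" if n: "n \<in># M" for n
  proof -
    have "obeys_rule un ov mul (g0 \<circ> join_map w') n \<longleftrightarrow> obeys_rule un ov mul f n"
      using M[OF n] g0 g(1) by (intro obeys_rule_cong) (metis UnI1)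
    then show ?thesis using fM n by blast
  qed
  ultimately have "g0 \<in> colorings Q un ov mul (join w' (Diagram (S \<union> I') (M + T')))"
    unfolding colorings_join by (auto simp: g0_def)
  moreover have "b = along S (join_map w') g0"
    unfolding b along_eq_iff using g0 g(1) by (auto simp: f_def)
  ultimately show "b \<in> along S (join_map w') ` colorings Q un ov mul
      (join w' (Diagram (S \<union> I') (M + T')))"
    by blast
qed

end

lemma Y_oriented_tangle:
  assumes Y: "Y_oriented_diagram (Diagram (S \<union> I) (M + T))" and "S \<inter> I = {}"
  shows "tangle S I T"
proof -
  let ?D = "Diagram (S \<union> I) (M + T)"
  have D: "dart_mset ?D = (\<Sum>n\<in>#M. node_darts n) + (\<Sum>n\<in>#T. node_darts n)"
    by (simp add: dart_mset_def)
  have sub: "fst ` set_mset (dart_mset ?D) \<subseteq> S \<union> I"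
    using Y by (simp add: Y_oriented_diagram_def)
  have le: "count (dart_mset ?D) d \<le> 1" for d
  proof (cases d)
    case (Pair e s)
    show ?thesis
    proof (cases "e \<in> S \<union> I")
      case True
      then show ?thesis
        using Y unfolding Pair Y_oriented_diagram_def by (cases s) force+
    next
      case False
      then have "d \<notin># dart_mset ?D"
        using sub Pair by force
      then show ?thesis
        by (simp add: not_in_iff)
    qed
  qed
  have "count (\<Sum>n\<in>#T. node_darts n) d \<le> 1" for d
    using le[of d] unfolding D by simp
  moreover have "\<forall>d\<in>#(\<Sum>n\<in>#T. node_darts n). fst d \<in> S \<union> I"
    using sub unfolding D by auto
  moreover have "\<forall>n\<in>#T. Y_oriented_node n"
    using Y by (simp add: Y_oriented_diagram_def)
  ultimately show ?thesis
    using assms(2) unfolding tangle_def by blast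
qed

lemma handlebody_move_inner_darts:
  assumes "handlebody_move I T I' T' w" "e \<in> I"
  shows "(e, s) \<in># (\<Sum>n\<in>#T. node_darts n)"
  using assms by cases (cases s; auto)+

text \<open>
  Both ends of an inner semiarc lie inside the disc and darts are not repeated, so the
  nodes outside see no inner semiarc.
\<close>

lemma outer_darts:
  assumes move: "handlebody_move I T I' T' w"
    and Y: "Y_oriented_diagram (Diagram (S \<union> I) (M + T))" and "S \<inter> I = {}"
    and n: "n \<in># M" and d: "d \<in># node_darts n"
  shows "fst d \<in> S"
proof -
  have T: "tangle S I (M + T)"
    using Y_oriented_tangle[of S I "{#}" "M + T"] Y assms(3) by simp
  have dM: "d \<in># (\<Sum>n\<in>#M. node_darts n)"
    using n d by auto
  then have "1 \<le> count (\<Sum>n\<in>#M. node_darts n) d"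
    by (simp add: Suc_leI)
  moreover have "count (\<Sum>n\<in>#M. node_darts n) d + count (\<Sum>n\<in>#T. node_darts n) d \<le> 1"
    using T unfolding tangle_def by (metis count_union image_mset_union sum_mset.union)
  ultimately have "count (\<Sum>n\<in>#T. node_darts n) d = 0"
    by linarith
  then have "d \<notin># (\<Sum>n\<in>#T. node_darts n)"
    unfolding not_in_iff .
  then have "fst d \<notin> I"
    using handlebody_move_inner_darts[OF move] by (metis prod.collapse)
  moreover have "fst d \<in> S \<union> I"
    using T dM unfolding tangle_def by simp
  ultimately show ?thesis by blast
qed

text \<open>
  When semiarcs are joined, nothing remains inside the disc; otherwise the diagram after the move is
  literally the union of the outer part and \<open>T'\<close>.
\<close>

lemma handlebody_move_tangle_after:
  assumes move: "handlebody_move I T I' T' w" and "S \<inter> I' = {}"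
    and Y: "Y_oriented_diagram (join w (Diagram (S \<union> I') (M + T')))"
  shows "tangle S I' T'"
proof (cases "w = []")
  case True
  then show ?thesis
    using Y_oriented_tangle Y assms(2) by simp
next
  case False
  then have "I' = {}" "T' = {#}"
    using move by (auto elim: handlebody_move.cases)
  then show ?thesis
    by (simp add: tangle_def)
qed

context reversible_biquandle
begin

lemma move_same_boundary:
  assumes move: "handlebody_move I T I' T' w" and disj: "S \<inter> I = {}" "S \<inter> I' = {}"
    and Y: "Y_oriented_diagram (Diagram (S \<union> I) (M + T))"
    and Y': "Y_oriented_diagram (join w (Diagram (S \<union> I') (M + T')))"
  shows "same_boundary S id (join_map w) (colorings Q un ov mul (Diagram (S \<union> I) (M + T)))
    (colorings Q un ov mul (join w (Diagram (S \<union> I') (M + T'))))"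
proof -
  have T: "tangle S I T" and T': "tangle S I' T'"
    using Y_oriented_tangle[OF Y disj(1)] handlebody_move_tangle_after[OF move disj(2) Y'] by auto
  have M: "fst d \<in> S" if "n \<in># M" "d \<in># node_darts n" for n d
    using outer_darts[OF move Y disj(1) that] .
  have inter: "determined S I T" "determined S I' T'"
    "extends_to S I T [] I' T' w" "extends_to S I' T' w I T []"
    using handlebody_move_interchangeable[OF move T T'] by (auto simp: interchangeable_def)
  show ?thesis
    unfolding same_boundary_def
    using inj_on_along_join[OF inter(1), of "[]" M] inj_on_along_join[OF inter(2), of w M]
      along_join_subset[OF inter(3) T' M] along_join_subset[OF inter(4) T M]
    by (simp add: subset_antisym)
qed

end

text \<open>
  Here the boundary is the whole diagram: an injective renaming transports colorings bijectively.
\<close>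

lemma rename_same_boundary:
  assumes inj: "inj_on r (semiarcs D)" and darts: "fst ` set_mset (dart_mset D) \<subseteq> semiarcs D"
  shows "same_boundary (semiarcs D) id r (colorings Q un ov mul D)
    (colorings Q un ov mul (relabel r D))"
proof -
  let ?S = "semiarcs D" and ?C = "colorings Q un ov mul D" and ?C' = "colorings Q un ov mul (relabel r D)"
  have inS: "fst d \<in> ?S" if "n \<in># nodes D" "d \<in># node_darts n" for n d
    using darts that by (auto simp: dart_mset_def)
  have id: "along ?S id f = f" if "f \<in> ?C" for f
    using that by (auto simp: along_def colorings_def PiE_def extensional_restrict)
  have "inj_on (along ?S id) ?C"
    using id by (metis inj_onI)
  moreover have "inj_on (along ?S r) ?C'"
  proof (rule inj_onI)
    fix f g assume "f \<in> ?C'" "g \<in> ?C'" "along ?S r f = along ?S r g"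
    then show "f = g"
      unfolding colorings_relabel along_eq_iff
      by (intro extensionalityI[of f "r ` ?S" g]) auto
  qed
  moreover have "along ?S id ` ?C = along ?S r ` ?C'"
  proof (intro equalityI subsetI)
    fix b assume "b \<in> along ?S id ` ?C"
    then have b: "b \<in> ?C" and b': "b = along ?S id b"
      using id by auto
    define f where "f = restrict (b \<circ> inv_into ?S r) (r ` ?S)"
    have f: "f (r e) = b e" if "e \<in> ?S" for e
      using that inj by (simp add: f_def)
    have "obeys_rule un ov mul (f \<circ> r) n" if "n \<in># nodes D" for n
    proof -
      have "obeys_rule un ov mul (f \<circ> r) n \<longleftrightarrow> obeys_rule un ov mul b n"
        using f inS[OF that] by (intro obeys_rule_cong) simp
      then show ?thesis using b that by (simp add: colorings_def)
    qed
    then have "f \<in> ?C'"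
      using b f unfolding colorings_relabel by (auto simp: f_def colorings_def)
    moreover have "b = along ?S r f"
      by (subst b') (simp add: along_eq_iff f)
    ultimately show "b \<in> along ?S r ` ?C'"
      by blast
  next
    fix b assume "b \<in> along ?S r ` ?C'"
    then obtain f where f: "f \<in> ?C'" "b = along ?S r f"
      by blast
    have "obeys_rule un ov mul b n" if "n \<in># nodes D" for n
    proof -
      have "obeys_rule un ov mul b n \<longleftrightarrow> obeys_rule un ov mul (f \<circ> r) n"
        using f inS[OF that] by (intro obeys_rule_cong) (simp add: along_def)
      then show ?thesis using f that by (simp add: colorings_relabel)
    qed
    moreover have "\<forall>e\<in>?S. f (r e) \<in> Q"
      using f unfolding colorings_relabel by blast
    ultimately have "b \<in> ?C"
      using f(2) by (auto simp: colorings_def along_def)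
    then show "b \<in> along ?S id ` ?C"
      using id by (metis imageI)
  qed
  ultimately show ?thesis
    by (simp add: same_boundary_def)
qed

lemma colorings_rotate_crossing:
  assumes "Y_oriented_node (Crossing a b c d)"
  shows "colorings Q un ov mul (Diagram S (add_mset (Crossing a b c d) M)) =
    colorings Q un ov mul (Diagram S (add_mset (Crossing c d a b) M))"
  using assms
  by (auto simp: colorings_def right_under_def left_under_def right_over_def left_over_def Let_def)

lemma colorings_rotate_vertex:
  assumes "Y_oriented_node (Vertex a b c)"
  shows "colorings Q un ov mul (Diagram S (add_mset (Vertex a b c) M)) =
    colorings Q un ov mul (Diagram S (add_mset (Vertex b c a) M))"
  using assms by (auto simp: colorings_def right_left_third_def)

section \<open>Groups and families of biquandles\<close>

context group
begin

lemma inv_cancel_left: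
  assumes "x \<in> carrier G" "y \<in> carrier G"
  shows "inv x \<otimes> (x \<otimes> y) = y" and "x \<otimes> (inv x \<otimes> y) = y"
  using assms by (simp_all flip: m_assoc)

lemmas group_simps = m_assoc inv_mult_group inv_cancel_left

lemma conjugation_reversible_biquandle:
  "reversible_biquandle (carrier G) (\<lambda>g h. inv h \<otimes> g \<otimes> h) (\<lambda>g h. g) (\<lambda>g h k. k = g \<otimes> h)
     (\<lambda>g. inv g)"
  by unfold_locales (auto simp: group_simps)

end

context G_family_of_biquandles
begin

lemma un_square_mult:
  assumes "g \<in> carrier G" "h \<in> carrier G" "a \<in> X"
  shows "un h (un g a a) (un g a a) = un (g \<otimes> h) a a"
  using assms by (simp add: un_mult)

text \<open>
  The map \<open>a \<mapsto> un \<one> a a\<close> is idempotent by multiplicativity and injective by the bijection of pairs,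
  hence the identity.
\<close>

lemma un_square_one:
  assumes "a \<in> X" shows "un \<one> a a = a"
proof -
  let ?S = "\<lambda>(x, y). (ov \<one> y x, un \<one> x y)"
  have "inj_on ?S (X \<times> X)"
    using pair_bij[of \<one> \<one>] by (simp add: bij_betw_def)
  moreover have "?S (un \<one> a a, un \<one> a a) = ?S (a, a)"
    using assms un_square_mult[of \<one> \<one> a] by (simp add: un_closed flip: diag)
  ultimately have "(un \<one> a a, un \<one> a a) = (a, a)"
    by (rule inj_onD) (simp_all add: assms un_closed)
  then show ?thesis by simp
qed

lemma un_one:
  assumes "a \<in> X" "b \<in> X" shows "un \<one> a b = a"
proof -
  have "un \<one> (un \<one> a b) b = un \<one> a b"
    using un_mult[of \<one> \<one> a b] assms by (simp add: un_square_one)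
  then show ?thesis
    using un_bij[of \<one> b] assms by (auto simp: bij_betw_def un_closed dest: inj_onD)
qed

lemma ov_one:
  assumes "a \<in> X" "b \<in> X" shows "ov \<one> a b = a"
proof -
  have "ov \<one> (ov \<one> a b) b = ov \<one> a b"
    using ov_mult[of \<one> \<one> a b] assms by (simp add: un_square_one flip: diag)
  then show ?thesis
    using ov_bij[of \<one> b] assms by (auto simp: bij_betw_def ov_closed dest: inj_onD)
qed

text \<open>
  Inverting the group element makes the action of a reversed strand undo that of the strand.  The
  first component must move to \<open>un g a a\<close>, since this is the element by which \<open>un_mult\<close> lets
  the second factor \<open>g\<^sup>-\<^sup>1\<close> act.
\<close>

definition reverse_color :: "'x \<times> 'g \<Rightarrow> 'x \<times> 'g" where
  "reverse_color p = (un (snd p) (fst p) (fst p), inv (snd p))"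

lemma un_inv:
  assumes "g \<in> carrier G" "a \<in> X" "b \<in> X"
  shows "un (inv g) (un g a b) (un g b b) = a" "ov (inv g) (ov g a b) (un g b b) = a"
  using assms un_mult[of g "inv g" a b] ov_mult[of g "inv g" a b]
  by (simp_all add: un_one ov_one flip: diag)

text \<open>
  In the second components every law is a group identity.  In the first components the laws without
  an exchange axiom follow from the diagonal axiom, multiplicativity and the triviality of the
  operations of \<open>\<one>\<close>; the effect of reversal on a result and the laws \<open>mul_un\<close>, \<open>mul_ov\<close> are exchange axioms
  with two arguments equal.
\<close>

lemma colors_reversible_biquandle:
  "reversible_biquandle (X \<times> carrier G) (Q_un G un) (Q_ov ov)
     (\<lambda>p q t. (p, q) \<in> Q_dom G X un \<and> t = Q_mult G p q) reverse_color"
proof -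
  note defs = Q_un_def Q_ov_def Q_dom_def Q_mult_def reverse_color_def
  note simps = group_simps un_closed ov_closed un_square_mult un_square_one un_inv
  show ?thesis
  proof (unfold_locales, goal_cases un_closed ov_closed opp_closed opp_opp un_self opp_square
      un_opp ov_opp opp_un opp_ov ex_un_un ex_ov_un ex_ov_ov mul_functional mul_rotate
      mul_opp mul_assoc mul_un mul_ov un_mul ov_mul mul_swap_un mul_swap_ov)
    case (un_self x)
    then show ?case
      by (auto simp: defs diag)
  next
    case (opp_un x y)
    then show ?case
      using exchange_un_un[of "snd x" "snd y" "fst x" "fst x" "fst y"] by (auto simp: defs simps)
  next
    case (opp_ov x y)
    then show ?case
      using exchange_ov_un[of "snd y" "snd x" "fst x" "fst y" "fst x"] by (auto simp: defs simps)
  next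
    case (ex_un_un x y z)
    then show ?case
      using exchange_un_un[of "snd y" "snd z" "fst x" "fst y" "fst z"] by (auto simp: defs simps)
  next
    case (ex_ov_un x y z)
    then show ?case
      using exchange_ov_un[of "snd y" "snd z" "fst x" "fst y" "fst z"] by (auto simp: defs simps)
  next
    case (ex_ov_ov x y z)
    then show ?case
      using exchange_ov_ov[of "snd y" "snd z" "fst x" "fst y" "fst z"] by (auto simp: defs simps)
  next
    case (mul_un x y z t)
    then show ?case
      using exchange_un_un[of "snd x" "snd t" "fst x" "fst x" "fst t"] by (auto simp: defs simps)
  next
    case (mul_ov x y z t)
    then show ?case
      using exchange_ov_un[of "snd t" "snd x" "fst x" "fst t" "fst x"] by (auto simp: defs simps)
  next
    case (un_mul x y z t)
    then show ?case
      by (auto simp: defs simps un_mult)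
  next
    case (ov_mul x y z t)
    then show ?case
      by (auto simp: defs simps ov_mult diag)
  qed (auto simp: defs simps simp flip: diag)
qed

end

section \<open>The invariant from boundary values\<close>

text \<open>
  The operations of \<open>X \<times> G\<close> project to conjugation, the trivial operation and the product of \<open>G\<close>.
\<close>

lemma project_coloring:
  assumes f: "f \<in> X_colorings G X un ov D" and Y: "Y_oriented_diagram D"
  shows "restrict (\<lambda>e. snd (f e)) (semiarcs D) \<in> G_colorings G D" (is "?g \<in> _")
proof -
  have "obeys_rule (\<lambda>g h. inv\<^bsub>G\<^esub> h \<otimes>\<^bsub>G\<^esub> g \<otimes>\<^bsub>G\<^esub> h) (\<lambda>g h. g) (\<lambda>g h k. k = g \<otimes>\<^bsub>G\<^esub> h) ?g n"
    if n: "n \<in># nodes D" for n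
  proof -
    have "fst d \<in> semiarcs D" if "d \<in># node_darts n" for d
      using Y n that by (auto simp: Y_oriented_diagram_def dart_mset_def)
    then have "obeys_rule (\<lambda>g h. inv\<^bsub>G\<^esub> h \<otimes>\<^bsub>G\<^esub> g \<otimes>\<^bsub>G\<^esub> h) (\<lambda>g h. g) (\<lambda>g h k. k = g \<otimes>\<^bsub>G\<^esub> h) ?g n \<longleftrightarrow>
      obeys_rule (\<lambda>g h. inv\<^bsub>G\<^esub> h \<otimes>\<^bsub>G\<^esub> g \<otimes>\<^bsub>G\<^esub> h) (\<lambda>g h. g) (\<lambda>g h k. k = g \<otimes>\<^bsub>G\<^esub> h) (\<lambda>e. snd (f e)) n"
      by (intro obeys_rule_cong) simp
    moreover have "obeys_rule (Q_un G un) (Q_ov ov)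
        (\<lambda>p q t. (p, q) \<in> Q_dom G X un \<and> t = Q_mult G p q) f n"
      using f n by (simp add: X_colorings_def colorings_def)
    ultimately show ?thesis
      by (cases n) (auto simp: Let_def Q_un_def Q_ov_def Q_mult_def split: prod.splits)
  qed
  moreover have "snd (f e) \<in> carrier G" if "e \<in> semiarcs D" for e
    using f that by (auto simp: X_colorings_def colorings_def PiE_def Pi_def mem_Times_iff)
  ultimately show ?thesis
    by (auto simp: G_colorings_def colorings_def)
qed

definition boundary_fiber :: "nat set \<Rightarrow> (nat \<Rightarrow> 'x \<times> 'g) set \<Rightarrow> (nat \<Rightarrow> 'g) \<Rightarrow> (nat \<Rightarrow> 'x \<times> 'g) set" where
  "boundary_fiber S B \<phi> = {b \<in> B. restrict (\<lambda>s. snd (b s)) S = \<phi>}"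

text \<open>
  Forgetting the first component commutes with restriction to the boundary, and \<open>\<psi>\<close> is known from its
  boundary values, so fibers correspond to fibers.
\<close>

lemma fiber_eqpoll_boundary_fiber:
  fixes G :: "('g, 'm) monoid_scheme" and X :: "'x set"
  assumes Y: "Y_oriented_diagram D" and r: "r ` S \<subseteq> semiarcs D"
    and inj: "inj_on (along S r) (X_colorings G X un ov D)"
    and injG: "inj_on (along S r) (G_colorings G D)" and \<psi>: "\<psi> \<in> G_colorings G D"
  shows "fiber G X un ov D \<psi> \<approx>
    boundary_fiber S (along S r ` X_colorings G X un ov D) (along S r \<psi>)"
proof -
  let ?pr = "\<lambda>f. restrict (\<lambda>e. snd (f e)) (semiarcs D)"
  have pr: "along S r (?pr f) = restrict (\<lambda>s. snd (along S r f s)) S" for f :: "nat \<Rightarrow> 'x \<times> 'g"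
    using r by (auto simp: along_def restrict_def fun_eq_iff)
  have "?pr f = \<psi> \<longleftrightarrow> along S r (?pr f) = along S r \<psi>" if "f \<in> X_colorings G X un ov D" for f
    using inj_on_eq_iff[OF injG project_coloring[OF that Y] \<psi>] by simp
  then have "boundary_fiber S (along S r ` X_colorings G X un ov D) (along S r \<psi>) =
      along S r ` fiber G X un ov D \<psi>"
    unfolding boundary_fiber_def fiber_def by (auto simp flip: pr)
  moreover have "inj_on (along S r) (fiber G X un ov D \<psi>)"
    using inj by (rule inj_on_subset) (auto simp: fiber_def)
  ultimately show ?thesis
    by (metis inj_on_image_eqpoll_self eqpoll_sym)
qed

lemma eqpoll_card_eq: "A \<approx> B \<Longrightarrow> card A = card B"
  by (metis bij_betw_same_card eqpoll_def)

text \<open>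
  The right-hand sides mention the diagram only through the two sets of boundary values.
\<close>

lemma Phi_eq_boundary:
  assumes "Y_oriented_diagram D" "r ` S \<subseteq> semiarcs D"
    "inj_on (along S r) (X_colorings G X un ov D)" "inj_on (along S r) (G_colorings G D)"
  shows "Phi G X un ov D = (\<Sum>\<phi>\<in>along S r ` G_colorings G D.
      monom 1 (card (boundary_fiber S (along S r ` X_colorings G X un ov D) \<phi>)))"
    and "Phi_terms G X un ov D K \<approx> {\<phi> \<in> along S r ` G_colorings G D.
      boundary_fiber S (along S r ` X_colorings G X un ov D) \<phi> \<approx> K}"
proof -
  let ?B = "along S r ` X_colorings G X un ov D"
  note eqp = fiber_eqpoll_boundary_fiber[OF assms]
  show "Phi G X un ov D = (\<Sum>\<phi>\<in>along S r ` G_colorings G D.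
      monom 1 (card (boundary_fiber S ?B \<phi>)))"
    unfolding Phi_def sum.reindex[OF assms(4)]
    by (intro sum.cong) (auto dest!: eqp eqpoll_card_eq)
  have "{\<phi> \<in> along S r ` G_colorings G D. boundary_fiber S ?B \<phi> \<approx> K} =
      along S r ` Phi_terms G X un ov D K"
    unfolding Phi_terms_def using eqp by (auto intro: eqpoll_trans dest: eqpoll_sym)
  moreover have "inj_on (along S r) (Phi_terms G X un ov D K)"
    using assms(4) by (rule inj_on_subset) (auto simp: Phi_terms_def)
  ultimately show "Phi_terms G X un ov D K \<approx> {\<phi> \<in> along S r ` G_colorings G D.
      boundary_fiber S ?B \<phi> \<approx> K}"
    by (metis inj_on_image_eqpoll_self eqpoll_sym)
qed

definition same_invariant :: "('g, 'm) monoid_scheme \<Rightarrow> 'x set \<Rightarrow> ('g \<Rightarrow> 'x \<Rightarrow> 'x \<Rightarrow> 'x) \<Rightarrow>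
    ('g \<Rightarrow> 'x \<Rightarrow> 'x \<Rightarrow> 'x) \<Rightarrow> diagram \<Rightarrow> diagram \<Rightarrow> bool" where
  "same_invariant G X un ov D D' \<longleftrightarrow> Phi G X un ov D = Phi G X un ov D' \<and>
     (\<forall>K. Phi_terms G X un ov D K \<approx> Phi_terms G X un ov D' K)"

lemma same_invariant_of_same_boundary:
  assumes "Y_oriented_diagram D" "Y_oriented_diagram D'"
    and "r ` S \<subseteq> semiarcs D" "r' ` S \<subseteq> semiarcs D'"
    and "same_boundary S r r' (X_colorings G X un ov D) (X_colorings G X un ov D')"
    and "same_boundary S r r' (G_colorings G D) (G_colorings G D')"
  shows "same_invariant G X un ov D D'"
proof -
  note D = Phi_eq_boundary[OF assms(1,3), of G X un ov]
    and D' = Phi_eq_boundary[OF assms(2,4), of G X un ov]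
  have inj: "inj_on (along S r) (X_colorings G X un ov D)" "inj_on (along S r) (G_colorings G D)"
    "inj_on (along S r') (X_colorings G X un ov D')" "inj_on (along S r') (G_colorings G D')"
    and eq: "along S r ` X_colorings G X un ov D = along S r' ` X_colorings G X un ov D'"
    "along S r ` G_colorings G D = along S r' ` G_colorings G D'"
    using assms(5,6) unfolding same_boundary_def by blast+
  have "Phi G X un ov D = Phi G X un ov D'"
    unfolding D(1)[OF inj(1,2)] D'(1)[OF inj(3,4)] eq ..
  moreover have "Phi_terms G X un ov D K \<approx> Phi_terms G X un ov D' K" for K
    using D(2)[OF inj(1,2), of K] D'(2)[OF inj(3,4), of K] eqpoll_trans eqpoll_sym
    unfolding eq by blast
  ultimately show ?thesis
    by (simp add: same_invariant_def)
qed

lemma same_invariant_of_same_colorings: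
  assumes "semiarcs D = semiarcs D'" "X_colorings G X un ov D = X_colorings G X un ov D'"
    "G_colorings G D = G_colorings G D'"
  shows "same_invariant G X un ov D D'"
  using assms by (simp add: same_invariant_def Phi_def Phi_terms_def fiber_def)

text \<open>
  The boundary comparison is applied twice with the same \<open>S\<close> and the same renamings, to the
  colors \<open>X \<times> G\<close> and to \<open>G\<close> itself; this is what keeps fibers over corresponding \<open>\<psi>\<close> together.
\<close>

lemma diagram_step_same_invariant:
  assumes "G_family_of_biquandles G X un ov"
    and step: "diagram_step D D'" and Y: "Y_oriented_diagram D" and Y': "Y_oriented_diagram D'"
  shows "same_invariant G X un ov D D'"
proof -
  interpret G_family_of_biquandles G X un ov by fact
  from step show ?thesis
  proof cases
    case (rename r)
    have darts: "fst ` set_mset (dart_mset D) \<subseteq> semiarcs D"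
      using Y by (simp add: Y_oriented_diagram_def)
    have "same_boundary (semiarcs D) id r (X_colorings G X un ov D) (X_colorings G X un ov D')"
      "same_boundary (semiarcs D) id r (G_colorings G D) (G_colorings G D')"
      unfolding X_colorings_def G_colorings_def rename(1)
      by (rule rename_same_boundary[OF rename(2) darts])+
    then show ?thesis
      using Y Y' by (intro same_invariant_of_same_boundary) (auto simp: rename(1) relabel_def)
  next
    case (rotate_crossing S a b c d M)
    then have Yn: "Y_oriented_node (Crossing a b c d)"
      using Y by (simp add: Y_oriented_diagram_def)
    show ?thesis
      unfolding rotate_crossing by (rule same_invariant_of_same_colorings)
        (simp_all only: X_colorings_def G_colorings_def diagram.sel colorings_rotate_crossing[OF Yn])
  next
    case (rotate_vertex S a b c M)
    then have Yn: "Y_oriented_node (Vertex a b c)"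
      using Y by (simp add: Y_oriented_diagram_def)
    show ?thesis
      unfolding rotate_vertex by (rule same_invariant_of_same_colorings)
        (simp_all only: X_colorings_def G_colorings_def diagram.sel colorings_rotate_vertex[OF Yn])
  next
    case (move I T I' T' w S M)
    note Ys = Y[unfolded move(1)] Y'[unfolded move(2)]
    have "same_boundary S id (join_map w) (X_colorings G X un ov D) (X_colorings G X un ov D')"
      unfolding X_colorings_def move(1,2) using colors_reversible_biquandle move(3-5) Ys
      by (rule reversible_biquandle.move_same_boundary)
    moreover have "same_boundary S id (join_map w) (G_colorings G D) (G_colorings G D')"
      unfolding G_colorings_def move(1,2) using conjugation_reversible_biquandle move(3-5) Ys
      by (rule reversible_biquandle.move_same_boundary)
    moreover have "id ` S \<subseteq> semiarcs D" "join_map w ` S \<subseteq> semiarcs D'"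
      unfolding move(1,2) join_eq_relabel by (auto simp: relabel_def)
    ultimately show ?thesis
      by (intro same_invariant_of_same_boundary[OF Y Y'])
  qed
qed

theorem proposition6p3:
  fixes G :: "('g, 'm) monoid_scheme"
    and X :: "'x set"
    and un ov :: "'g \<Rightarrow> 'x \<Rightarrow> 'x \<Rightarrow> 'x"
    and \<Gamma> \<Gamma>' :: diagram
  assumes "Y_oriented_diagram \<Gamma>"
    and "Y_oriented_diagram \<Gamma>'"
    and "Reidemeister_related \<Gamma> \<Gamma>'"
    and "G_family_of_biquandles G X un ov"
  shows "Phi G X un ov \<Gamma> = Phi G X un ov \<Gamma>' \<and>
    (\<forall>K. Phi_terms G X un ov \<Gamma> K \<approx> Phi_terms G X un ov \<Gamma>' K)"
proof -
  let ?step = "\<lambda>D D'. Y_oriented_diagram D \<and> Y_oriented_diagram D' \<and> diagram_step D D'"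
  have "(symclp ?step)\<^sup>*\<^sup>* \<Gamma> \<Gamma>'"
    using assms(3) by (simp add: Reidemeister_related_def equivclp_def)
  then have "same_invariant G X un ov \<Gamma> \<Gamma>'"
  proof induction
    case base
    show ?case
      by (simp add: same_invariant_def)
  next
    case (step D D')
    then have "same_invariant G X un ov D D' \<or> same_invariant G X un ov D' D"
      using diagram_step_same_invariant[OF assms(4)] by (auto simp: symclp_def)
    with step.IH show ?case
      unfolding same_invariant_def by (metis eqpoll_sym eqpoll_trans)
  qed
  then show ?thesis
    by (simp add: same_invariant_def)
qed

end
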